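(* Let $1<a<\infty$, $1<r<\infty$ and $\beta\in\mathbb R\setminus\{0\}$. If $\beta<0$, there exist $1<p<q<\infty$, $\alpha>0$ and $\theta\in(0,1)$ such that $L^{a,r}(\log L)^{\beta}=\bigl(L^{p),\alpha}(\Omega),L^{q),\alpha}(\Omega)\bigr)_{\theta,r}$ with equivalent norms. If $\beta>0$, there exist $1<p<q<\infty$, $\alpha>0$ and $\theta\in(0,1)$ such that $L^{a,r}(\log L)^{\beta}=\bigl(L^{(p,\alpha}(\Omega),L^{(q,\alpha}(\Omega)\bigr)_{\theta,r}$ with equivalent norms.
   Context: $\Omega\subset\mathbb R^n$ is a bounded open set with $|\Omega|=1$; $f_*$ is the decreasing rearrangement of $|f|$ on $(0,1)$; $\log$ is the natural logarithm. Grand Lebesgue space: $L^{p),\alpha}(\Omega)$: measurable $f$ with $\|f\|_{p),\alpha}=\sup_{0<t<1}(1-\log t)^{-\alpha/p}(\int_t^1 f_*^p)^{1/p}<\infty$. Small Lebesgue space: $L^{(p,\alpha}(\Omega)$: measurable $f$ with $\|f\|_{(p,\alpha}=\int_0^1(1-\log t)^{-\frac{\alpha}{p}+\alpha-1}(\int_0^t f_*^p)^{1/p}\frac{dt}{t}<\infty$. Lorentz–Zygmund space: $L^{a,r}(\log L)^{\beta}$: measurable $f$ with $\bigl(\int_0^1[t^{1/a}(1-\log t)^{\beta}f_*(t)]^r\frac{dt}{t}\bigr)^{1/r}<\infty$. K-functional: $K(g,t;X_0,X_1)=\inf_{g=g_0+g_1}(\|g_0\|_{X_0}+t\|g_1\|_{X_1})$;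 $(X_0,X_1)_{\theta,r}$ is the set of $g\in X_0+X_1$ with $\bigl(\int_0^1[t^{-\theta}K(g,t)]^r\frac{dt}{t}\bigr)^{1/r}<\infty$. *)

theory Defs
  imports "HOL-Analysis.Analysis"
begin

text \<open>Power of an extended nonnegative real by a real exponent (used with positive exponents):
  infinity stays infinity.\<close>
definition enn_powr :: "ennreal \<Rightarrow> real \<Rightarrow> ennreal" where
  "enn_powr x e = (if x = \<infinity> then \<infinity> else ennreal (enn2real x powr e))"

definition decr_rearr :: "'a::euclidean_space set \<Rightarrow> ('a \<Rightarrow> real) \<Rightarrow> real \<Rightarrow> real" where
  "decr_rearr \<Omega> f t = Inf {s. 0 \<le> s \<and> measure (lebesgue_on \<Omega>) {x\<in>\<Omega>. s < \<bar>f x\<bar>} \<le> t}"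

definition grand_norm :: "'a::euclidean_space set \<Rightarrow> real \<Rightarrow> real \<Rightarrow> ('a \<Rightarrow> real) \<Rightarrow> ennreal" where
  "grand_norm \<Omega> p \<alpha> f =
     (SUP t\<in>{0<..<1}. ennreal ((1 - ln t) powr (- \<alpha> / p)) *
        enn_powr (\<integral>\<^sup>+ s. indicator {t..1} s * ennreal (decr_rearr \<Omega> f s powr p) \<partial>lborel) (1 / p))"

definition small_norm :: "'a::euclidean_space set \<Rightarrow> real \<Rightarrow> real \<Rightarrow> ('a \<Rightarrow> real) \<Rightarrow> ennreal" where
  "small_norm \<Omega> p \<alpha> f =
     (\<integral>\<^sup>+ t. indicator {0<..<1} t *
        ennreal ((1 - ln t) powr (- \<alpha> / p + \<alpha> - 1) / t) *
        enn_powr (\<integral>\<^sup>+ s. indicator {0..t} s * ennreal (decr_rearr \<Omega> f s powr p) \<partial>lborel) (1 / p)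
      \<partial>lborel)"

definition LZ_norm :: "'a::euclidean_space set \<Rightarrow> real \<Rightarrow> real \<Rightarrow> real \<Rightarrow> ('a \<Rightarrow> real) \<Rightarrow> ennreal" where
  "LZ_norm \<Omega> a r \<beta> f =
     enn_powr (\<integral>\<^sup>+ t. indicator {0<..<1} t *
        ennreal ((t powr (1 / a) * (1 - ln t) powr \<beta> * decr_rearr \<Omega> f t) powr r / t) \<partial>lborel) (1 / r)"

definition K_func :: "'a::euclidean_space set \<Rightarrow> (('a \<Rightarrow> real) \<Rightarrow> ennreal) \<Rightarrow> (('a \<Rightarrow> real) \<Rightarrow> ennreal)
    \<Rightarrow> ('a \<Rightarrow> real) \<Rightarrow> real \<Rightarrow> ennreal" where
  "K_func \<Omega> N0 N1 g t =
     (INF gg\<in>{(g0, g1). g0 \<in> borel_measurable (lebesgue_on \<Omega>) \<and> g1 \<in> borel_measurable (lebesgue_on \<Omega>)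
                \<and> (\<forall>x\<in>\<Omega>. g x = g0 x + g1 x)}.
        N0 (fst gg) + ennreal t * N1 (snd gg))"

definition interp_norm :: "'a::euclidean_space set \<Rightarrow> (('a \<Rightarrow> real) \<Rightarrow> ennreal) \<Rightarrow> (('a \<Rightarrow> real) \<Rightarrow> ennreal)
    \<Rightarrow> real \<Rightarrow> real \<Rightarrow> ('a \<Rightarrow> real) \<Rightarrow> ennreal" where
  "interp_norm \<Omega> N0 N1 \<theta> r g =
     enn_powr (\<integral>\<^sup>+ t. indicator {0<..<1} t *
        enn_powr (ennreal (t powr (- \<theta>)) * K_func \<Omega> N0 N1 g t) r * ennreal (1 / t) \<partial>lborel) (1 / r)"

text \<open>Two (extended) norms define the same space with equivalent norms.\<close>
definition equiv_norms :: "'a::euclidean_space set \<Rightarrow> (('a \<Rightarrow> real) \<Rightarrow> ennreal) \<Rightarrow> (('a \<Rightarrow> real) \<Rightarrow> ennreal) \<Rightarrow> bool" where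
  "equiv_norms \<Omega> N M \<longleftrightarrow> (\<exists>c C. 0 < c \<and> 0 < C \<and>
     (\<forall>g\<in>borel_measurable (lebesgue_on \<Omega>).
        ennreal c * N g \<le> M g \<and> M g \<le> ennreal C * N g))"

end

theory Submission
  imports Defs
begin

text \<open>Both the grand and the small Lebesgue norm lie between the Marcinkiewicz quantity
  \<open>sup \<phi>\<^sub>p(t) f\<^sub>*(t)\<close> and the Lorentz norm \<open>\<integral> \<phi>\<^sub>p(s) f\<^sub>*(s) ds/s\<close> with the same fundamental function
  \<open>\<phi>\<^sub>p(t) = t\<^bsup>1/p\<^esup> (1 - log t)\<^bsup>\<kappa> - \<alpha>/p\<^esup>\<close>, where \<open>\<kappa> = 0\<close> in the grand and \<open>\<kappa> = \<alpha>\<close> in the small case.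
  The endpoint inequalities alone pin down the K-functional at
  \<open>\<rho> = \<phi>\<^sub>p / \<phi>\<^sub>q = (t (1 - log t)\<^bsup>-\<alpha>\<^esup>)\<^bsup>1/p - 1/q\<^esup>\<close> up to Hardy operators: from below
  since \<open>(g\<^sub>0 + g\<^sub>1)\<^sub>*(t) \<le> (g\<^sub>0)\<^sub>*(t/2) + (g\<^sub>1)\<^sub>*(t/2)\<close>, from above by cutting \<open>f\<close> at height \<open>f\<^sub>*(t)\<close>.
  Because \<open>\<rho>(s)/\<rho>(t) \<le> (s/t)\<^bsup>1/p - 1/q\<^esup>\<close> for \<open>s \<le> t\<close>, the Hardy operators are dominated by the kernel
  \<open>min(s/t, t/s)\<^sup>\<delta>\<close>, which the Schur test bounds on \<open>L\<^sup>r(ds/s)\<close>. Substituting \<open>u = \<rho>(t)\<close> in the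
  interpolation norm gives the Lorentz-Zygmund norm with \<open>1/a = (1 - \<theta>)/p + \<theta>/q\<close> and
  \<open>\<beta> = \<kappa> - \<alpha>/a\<close>; it remains to choose \<open>p < a < q\<close> and solve for \<open>\<theta>\<close> and \<open>\<alpha>\<close>.\<close>

section \<open>Powers of extended nonnegative reals and the Schur test\<close>

lemma enn_powr_ennreal [simp]: "0 \<le> x \<Longrightarrow> enn_powr (ennreal x) e = ennreal (x powr e)"
  by (simp add: enn_powr_def)

lemma enn_powr_top [simp]: "enn_powr top e = top"
  by (simp add: enn_powr_def)

lemma enn_powr_zero [simp]: "enn_powr 0 e = 0"
  by (simp add: enn_powr_def)

lemma enn_powr_mono: "x \<le> y \<Longrightarrow> 0 \<le> e \<Longrightarrow> enn_powr x e \<le> enn_powr y e"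
  by (cases x; cases y) (auto simp: powr_mono2 top_unique)

text \<open>True for every real exponent: with \<open>0 powr e = 0\<close>, the convention that 0
  times infinity is 0 gives the same value on both sides.\<close>

lemma enn_powr_mult: "enn_powr (x * y) e = enn_powr x e * enn_powr y e"
proof (cases x; cases y)
  fix a b assume "x = ennreal a" "y = ennreal b" "0 \<le> a" "0 \<le> b"
  then show ?thesis by (simp flip: ennreal_mult add: powr_mult)
next
  fix a assume "x = ennreal a" "0 \<le> a" "y = top"
  then show ?thesis by (cases "a = 0") (auto simp: ennreal_mult_top)
next
  fix a assume "y = ennreal a" "0 \<le> a" "x = top"
  then show ?thesis by (cases "a = 0") (auto simp: ennreal_top_mult)
qed simp

lemma enn_powr_powr: "enn_powr (enn_powr x d) e = enn_powr x (d * e)"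
  by (cases x) (auto simp: powr_powr)

lemma enn_powr_one [simp]: "enn_powr x 1 = x"
  by (cases x) auto

lemma measurable_enn_powr [measurable]:
  assumes [measurable]: "f \<in> borel_measurable M"
  shows "(\<lambda>x. enn_powr (f x) e) \<in> borel_measurable M"
  unfolding enn_powr_def by measurable

lemma enn_powr_add: "enn_powr x (d + e) = enn_powr x d * enn_powr x e"
  by (cases x) (auto simp: powr_add ennreal_mult)

lemma powr_tangent_le:
  fixes x y r :: real
  assumes "1 < r" "0 \<le> x" "0 < y"
  shows "r * y powr (r - 1) * x \<le> x powr r + (r - 1) * y powr r"
proof -
  define s where "s = r / (r - 1)"
  have s: "1 < s" "1 / r + 1 / s = 1" using assms by (auto simp: s_def field_simps)
  have "x * y powr (r - 1) \<le> x powr r / r + (y powr (r - 1)) powr s / s"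
    by (rule Youngs_inequality) (use assms s in auto)
  also have "(y powr (r - 1)) powr s = y powr r"
    using assms by (simp add: powr_powr s_def)
  finally have "r * (x * y powr (r - 1)) \<le> r * (x powr r / r + y powr r / s)"
    using assms by simp
  also have "\<dots> = x powr r + (r - 1) * y powr r"
    using assms by (simp add: s_def field_simps)
  finally show ?thesis by (simp add: mult_ac)
qed

text \<open>Integrate the tangent line of \<open>x\<^sup>r\<close> at the mean value.\<close>

lemma nn_integral_powr_jensen:
  fixes k G :: "'a \<Rightarrow> ennreal" and A r :: real
  assumes [measurable]: "k \<in> borel_measurable M" "G \<in> borel_measurable M"
    and "1 < r" "0 < A" and k: "(\<integral>\<^sup>+ s. k s \<partial>M) \<le> ennreal A"
  shows "enn_powr (\<integral>\<^sup>+ s. k s * G s \<partial>M) r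
          \<le> ennreal (A powr (r - 1)) * (\<integral>\<^sup>+ s. k s * enn_powr (G s) r \<partial>M)"
proof -
  define I J where "I = (\<integral>\<^sup>+ s. k s * G s \<partial>M)" and "J = (\<integral>\<^sup>+ s. k s * enn_powr (G s) r \<partial>M)"
  have tangent: "ennreal (r * y powr (r - 1)) * I \<le> J + ennreal ((r - 1) * y powr r * A)" if "0 < y" for y
  proof -
    have pt: "ennreal (r * y powr (r - 1)) * x \<le> enn_powr x r + ennreal ((r - 1) * y powr r)" for x
    proof (cases x)
      case (real z)
      then show ?thesis
        using powr_tangent_le[of r z y] assms that
        by (simp flip: ennreal_mult ennreal_plus add: ennreal_leI)
    qed simp
    have "ennreal (r * y powr (r - 1)) * I = (\<integral>\<^sup>+ s. k s * (ennreal (r * y powr (r - 1)) * G s) \<partial>M)"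
      unfolding I_def by (subst nn_integral_cmult[symmetric]) (auto simp: mult_ac)
    also have "\<dots> \<le> (\<integral>\<^sup>+ s. k s * (enn_powr (G s) r + ennreal ((r - 1) * y powr r)) \<partial>M)"
      by (intro nn_integral_mono mult_left_mono pt) auto
    also have "\<dots> = J + (\<integral>\<^sup>+ s. k s \<partial>M) * ennreal ((r - 1) * y powr r)"
      unfolding J_def by (simp add: distrib_left nn_integral_add nn_integral_multc)
    also have "(\<integral>\<^sup>+ s. k s \<partial>M) * ennreal ((r - 1) * y powr r) \<le> ennreal A * ennreal ((r - 1) * y powr r)"
      by (intro mult_right_mono k) auto
    also have "\<dots> = ennreal ((r - 1) * y powr r * A)"
      using assms by (simp flip: ennreal_mult add: mult_ac)
    finally show ?thesis by (simp add: add_left_mono)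
  qed
  have "enn_powr I r \<le> ennreal (A powr (r - 1)) * J"
  proof (cases J)
    case top
    then show ?thesis using assms by (simp add: ennreal_mult_top)
  next
    case (real j)
    \<comment> \<open>The tangent at y = 1 already shows that I is finite when J is, so that the
      mean value can be formed as a real number.\<close>
    have "ennreal r * I \<le> ennreal j + ennreal ((r - 1) * A)"
      using tangent[of 1] real by simp
    then have "I \<noteq> top"
      using assms real by (auto simp: ennreal_mult_top top_unique simp flip: ennreal_plus)
    then obtain i where i: "I = ennreal i" "0 \<le> i" by (cases I) auto
    show ?thesis
    proof (cases "i = 0")
      case False
      \<comment> \<open>The mean value of G for total mass A. Since i = y * A, the linear and the
        constant term of the tangent inequality both become multiples of y^r * A.\<close>
      define y where "y = i / A"
      have y: "0 < y" "i = y * A" using False i assms by (auto simp: y_def)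
      have "ennreal (r * y powr (r - 1) * i) \<le> ennreal (j + (r - 1) * y powr r * A)"
        using tangent[OF y(1)] real i assms by (simp flip: ennreal_mult ennreal_plus)
      then have "r * y powr (r - 1) * i \<le> j + (r - 1) * y powr r * A"
        using real assms by (subst (asm) ennreal_le_iff) auto
      moreover have "r * y powr (r - 1) * i = r * (y powr r * A)"
        using y by (simp add: powr_diff)
      ultimately have "r * (y powr r * A) \<le> j + (r - 1) * (y powr r * A)" by simp
      then have "y powr r * A \<le> j" by (simp add: left_diff_distrib)
      then have "A powr (r - 1) * (y powr r * A) \<le> A powr (r - 1) * j"
        by (intro mult_left_mono) auto
      moreover have "A powr (r - 1) * (y powr r * A) = i powr r"
        using y assms by (simp add: powr_mult powr_diff)
      ultimately show ?thesis
        using i real by (simp flip: ennreal_mult add: ennreal_leI)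
    qed (use i in simp)
  qed
  then show ?thesis by (simp add: I_def J_def)
qed

text \<open>Jensen in the variable s uses the first kernel bound and costs A^(r-1); after Fubini the
  second bound costs the remaining factor A. The bounds are asked for almost everywhere, so that for
  \<open>dlog\<close> only points of (0,1) have to be checked.\<close>

lemma schur_test:
  fixes k :: "'a \<Rightarrow> 'a \<Rightarrow> ennreal" and G :: "'a \<Rightarrow> ennreal" and A r :: real
  assumes "sigma_finite_measure M"
    and [measurable]: "case_prod k \<in> borel_measurable (M \<Otimes>\<^sub>M M)" "G \<in> borel_measurable M"
    and "1 < r" "0 < A"
    and 1: "AE t in M. (\<integral>\<^sup>+ s. k s t \<partial>M) \<le> ennreal A"
    and 2: "AE s in M. (\<integral>\<^sup>+ t. k s t \<partial>M) \<le> ennreal A"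
  shows "(\<integral>\<^sup>+ t. enn_powr (\<integral>\<^sup>+ s. k s t * G s \<partial>M) r \<partial>M)
          \<le> ennreal (A powr r) * (\<integral>\<^sup>+ s. enn_powr (G s) r \<partial>M)"
proof -
  interpret sigma_finite_measure M by fact
  interpret pair_sigma_finite M M ..
  have "(\<integral>\<^sup>+ t. enn_powr (\<integral>\<^sup>+ s. k s t * G s \<partial>M) r \<partial>M)
      \<le> (\<integral>\<^sup>+ t. ennreal (A powr (r - 1)) * (\<integral>\<^sup>+ s. k s t * enn_powr (G s) r \<partial>M) \<partial>M)"
  proof (rule nn_integral_mono_AE, use 1 AE_space in eventually_elim)
    case (elim t)
    then have [measurable]: "(\<lambda>s. k s t) \<in> borel_measurable M" by measurable
    show ?case by (rule nn_integral_powr_jensen) (use assms elim in auto)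
  qed
  also have "\<dots> = ennreal (A powr (r - 1)) * (\<integral>\<^sup>+ t. (\<integral>\<^sup>+ s. k s t * enn_powr (G s) r \<partial>M) \<partial>M)"
    by (rule nn_integral_cmult) measurable
  also have "(\<integral>\<^sup>+ t. (\<integral>\<^sup>+ s. k s t * enn_powr (G s) r \<partial>M) \<partial>M)
      = (\<integral>\<^sup>+ s. (\<integral>\<^sup>+ t. k s t * enn_powr (G s) r \<partial>M) \<partial>M)"
    by (rule Fubini') measurable
  also have "\<dots> = (\<integral>\<^sup>+ s. (\<integral>\<^sup>+ t. k s t \<partial>M) * enn_powr (G s) r \<partial>M)"
    by (intro nn_integral_cong nn_integral_multc) measurable
  also have "\<dots> \<le> (\<integral>\<^sup>+ s. ennreal A * enn_powr (G s) r \<partial>M)"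
    by (rule nn_integral_mono_AE, use 2 in eventually_elim) (simp add: mult_right_mono)
  also have "\<dots> = ennreal A * (\<integral>\<^sup>+ s. enn_powr (G s) r \<partial>M)"
    by (rule nn_integral_cmult) measurable
  also have "ennreal (A powr (r - 1)) * (ennreal A * (\<integral>\<^sup>+ s. enn_powr (G s) r \<partial>M))
     = ennreal (A powr (r - 1) * A) * (\<integral>\<^sup>+ s. enn_powr (G s) r \<partial>M)"
    using assms by (simp add: ennreal_mult mult.assoc)
  also have "A powr (r - 1) * A = A powr r"
    using assms by (simp add: powr_diff)
  finally show ?thesis by (simp add: mult_left_mono)
qed

section \<open>The measure \<open>ds/s\<close> and power-logarithmic weights\<close>

definition dlog :: "real measure" where
  "dlog = density lborel (\<lambda>s. indicator {0<..<1} s * ennreal (1 / s))"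

lemma sets_dlog [measurable_cong, simp]: "sets dlog = sets borel"
  by (simp add: dlog_def)

lemma space_dlog [simp]: "space dlog = UNIV"
  by (simp add: dlog_def)

lemma nn_integral_dlog:
  "f \<in> borel_measurable borel \<Longrightarrow>
    (\<integral>\<^sup>+ s. f s \<partial>dlog) = (\<integral>\<^sup>+ s. indicator {0<..<1} s * ennreal (1 / s) * f s \<partial>lborel)"
  unfolding dlog_def by (rule nn_integral_density) auto

lemma AE_dlogI: "(\<And>s. 0 < s \<Longrightarrow> s < 1 \<Longrightarrow> P s) \<Longrightarrow> AE s in dlog. P s"
  unfolding dlog_def by (subst AE_density) (auto intro!: AE_I2 split: split_indicator_asm)

lemma nn_integral_dlog_mono:
  "(\<And>s. 0 < s \<Longrightarrow> s < 1 \<Longrightarrow> f s \<le> g s) \<Longrightarrow> (\<integral>\<^sup>+ s. f s \<partial>dlog) \<le> (\<integral>\<^sup>+ s. g s \<partial>dlog)"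
  by (intro nn_integral_mono_AE AE_dlogI)

lemma nn_integral_dlog_cong:
  "(\<And>s. 0 < s \<Longrightarrow> s < 1 \<Longrightarrow> f s = g s) \<Longrightarrow> (\<integral>\<^sup>+ s. f s \<partial>dlog) = (\<integral>\<^sup>+ s. g s \<partial>dlog)"
  by (intro nn_integral_cong_AE AE_dlogI)

lemma sigma_finite_dlog: "sigma_finite_measure dlog"
  unfolding dlog_def
  by (subst sigma_finite_measure.sigma_finite_iff_density_finite[OF sigma_finite_lborel]) (auto intro!: AE_I2 split: split_indicator)

lemma nn_integral_dlog_powr_le:
  assumes "0 < \<delta>" "0 < t"
  shows "(\<integral>\<^sup>+ s. indicator {0<..t} s * ennreal (s powr \<delta>) \<partial>dlog) \<le> ennreal (t powr \<delta> / \<delta>)"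
proof -
  have "(\<integral>\<^sup>+ s. indicator {0<..t} s * ennreal (s powr \<delta>) \<partial>dlog)
      \<le> (\<integral>\<^sup>+ s. ennreal (s powr (\<delta> - 1)) * indicator {0..t} s \<partial>lborel)"
    by (subst nn_integral_dlog)
       (auto intro!: nn_integral_mono simp: powr_diff simp flip: ennreal_mult split: split_indicator)
  also have "\<dots> = ennreal (t powr (\<delta> - 1 + 1) / (\<delta> - 1 + 1))"
    by (intro nn_integral_has_integral_lebesgue' has_integral_powr_from_0) (use assms in auto)
  finally show ?thesis by simp
qed

lemma nn_integral_dlog_powr_tail_le:
  assumes "0 < \<delta>" "0 < t"
  shows "(\<integral>\<^sup>+ s. indicator {t..} s * ennreal (s powr - \<delta>) \<partial>dlog) \<le> ennreal (t powr - \<delta> / \<delta>)"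
proof -
  have "(\<integral>\<^sup>+ s. indicator {t..} s * ennreal (s powr - \<delta>) \<partial>dlog)
      \<le> (\<integral>\<^sup>+ s. ennreal (s powr (- \<delta> - 1)) * indicator {t..} s \<partial>lborel)"
    by (subst nn_integral_dlog)
       (auto intro!: nn_integral_mono simp: powr_diff simp flip: ennreal_mult split: split_indicator)
  also have "\<dots> = ennreal (- (t powr (- \<delta> - 1 + 1)) / (- \<delta> - 1 + 1))"
    by (intro nn_integral_has_integral_lebesgue' has_integral_powr_to_inf) (use assms in auto)
  finally show ?thesis by simp
qed

section \<open>The kernel min(s/t, t/s)^\<delta>, which combines the two Hardy operators, and its
  boundedness\<close>

definition hkernel :: "real \<Rightarrow> real \<Rightarrow> real \<Rightarrow> real" where
  "hkernel \<delta> s t = (if s \<le> t then (s / t) powr \<delta> else (t / s) powr \<delta>)"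

lemma hkernel_nonneg [simp]: "0 \<le> hkernel \<delta> s t"
  by (simp add: hkernel_def)

lemma hkernel_commute: "hkernel \<delta> s t = hkernel \<delta> t s"
  by (auto simp: hkernel_def)

lemma measurable_hkernel [measurable]:
  assumes [measurable]: "f \<in> borel_measurable M" "g \<in> borel_measurable M"
  shows "(\<lambda>x. hkernel \<delta> (f x) (g x)) \<in> borel_measurable M"
  unfolding hkernel_def by measurable

text \<open>Splitting at s = t leaves two pure power integrals, each contributing at most
  1/\<delta>. Counting the point s = t twice only enlarges the bound.\<close>

lemma nn_integral_hkernel_le:
  assumes "0 < \<delta>" "0 < t"
  shows "(\<integral>\<^sup>+ s. ennreal (hkernel \<delta> s t) \<partial>dlog) \<le> ennreal (2 / \<delta>)"
proof -
  have "(\<integral>\<^sup>+ s. ennreal (hkernel \<delta> s t) \<partial>dlog)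
    \<le> (\<integral>\<^sup>+ s. ennreal (t powr - \<delta>) * (indicator {0<..t} s * ennreal (s powr \<delta>))
          + ennreal (t powr \<delta>) * (indicator {t..} s * ennreal (s powr - \<delta>)) \<partial>dlog)"
    using assms
    by (intro nn_integral_dlog_mono)
       (auto simp: hkernel_def powr_divide powr_minus field_simps simp flip: ennreal_mult split: split_indicator)
  also have "\<dots> = ennreal (t powr - \<delta>) * (\<integral>\<^sup>+ s. indicator {0<..t} s * ennreal (s powr \<delta>) \<partial>dlog)
          + ennreal (t powr \<delta>) * (\<integral>\<^sup>+ s. indicator {t..} s * ennreal (s powr - \<delta>) \<partial>dlog)"
    by (simp add: nn_integral_add nn_integral_cmult)
  also have "\<dots> \<le> ennreal (t powr - \<delta>) * ennreal (t powr \<delta> / \<delta>) + ennreal (t powr \<delta>) * ennreal (t powr - \<delta> / \<delta>)"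
    by (intro add_mono mult_left_mono nn_integral_dlog_powr_le nn_integral_dlog_powr_tail_le assms) auto
  also have "\<dots> = ennreal (2 / \<delta>)"
    using assms by (simp flip: ennreal_mult ennreal_plus add: powr_minus field_simps)
  finally show ?thesis .
qed

text \<open>The Schur test with A = 2/\<delta>; by symmetry of the kernel one integral bound serves
  for both variables.\<close>

lemma hardy_inequality:
  assumes "1 < r" "0 < \<delta>" and [measurable]: "G \<in> borel_measurable borel"
  shows "(\<integral>\<^sup>+ t. enn_powr (\<integral>\<^sup>+ s. ennreal (hkernel \<delta> s t) * G s \<partial>dlog) r \<partial>dlog)
          \<le> ennreal ((2 / \<delta>) powr r) * (\<integral>\<^sup>+ s. enn_powr (G s) r \<partial>dlog)"
proof (intro schur_test sigma_finite_dlog AE_dlogI)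
  show "(\<integral>\<^sup>+ t. ennreal (hkernel \<delta> s t) \<partial>dlog) \<le> ennreal (2 / \<delta>)" if "0 < s" for s
    using nn_integral_hkernel_le[OF assms(2) that] by (simp add: hkernel_commute[of \<delta> s])
qed (use assms in \<open>auto intro: nn_integral_hkernel_le\<close>)

section \<open>Power-logarithmic weights, a family closed under products and powers\<close>

definition psi :: "real \<Rightarrow> real \<Rightarrow> real \<Rightarrow> real" where
  "psi c b t = t powr c * (1 - ln t) powr b"

lemma psi_nonneg [simp]: "0 \<le> psi c b t"
  by (simp add: psi_def)

lemma psi_pos: "0 < t \<Longrightarrow> t \<le> 1 \<Longrightarrow> 0 < psi c b t"
  using ln_le_minus_one[of t] by (simp add: psi_def)

lemma measurable_psi [measurable]:
  assumes [measurable]: "f \<in> borel_measurable M"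
  shows "(\<lambda>x. psi c b (f x)) \<in> borel_measurable M"
  unfolding psi_def by measurable

lemma psi_mult: "psi c b t * psi c' b' t = psi (c + c') (b + b') t"
  by (simp add: psi_def powr_add mult_ac)

lemma psi_powr: "psi c b t powr e = psi (c * e) (b * e) t"
  by (simp add: psi_def powr_mult powr_powr)

text \<open>Moving from t down to s at most halves the base of the power, and at most doubles 1 - ln
  t because ln 2 <= 1 <= 1 - ln t. The logarithm costs something only for b < 0; for b >= 0 its
  factor grows towards 0.\<close>

lemma psi_doubling:
  assumes "0 < t" "t \<le> 1" "t / 2 \<le> s" "s \<le> t" "0 \<le> c"
  shows "psi c b t \<le> 2 powr (c + \<bar>b\<bar>) * psi c b s"
proof -
  have s: "0 < s" "s \<le> 1" using assms by auto
  have 1: "t powr c \<le> (2 * s) powr c"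
    using assms by (intro powr_mono2) auto
  have lt: "ln t \<le> 0" "ln s \<le> ln t" using assms s by auto
  have ls: "1 - ln s \<le> 2 * (1 - ln t)"
  proof -
    have "ln t - ln 2 = ln (t / 2)" using assms by (simp add: ln_div)
    also have "\<dots> \<le> ln s" using assms s by simp
    finally show ?thesis using lt ln_le_minus_one[of "2::real"] by simp
  qed
  have 2: "(1 - ln t) powr b \<le> 2 powr \<bar>b\<bar> * (1 - ln s) powr b"
  proof (cases "0 \<le> b")
    case True
    then have "(1 - ln t) powr b \<le> 1 * (1 - ln s) powr b"
      using lt by (simp add: powr_mono2)
    also have "\<dots> \<le> 2 powr \<bar>b\<bar> * (1 - ln s) powr b"
      by (intro mult_right_mono) (auto intro: ge_one_powr_ge_zero)
    finally show ?thesis .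
  next
    case False
    then have "(2 * (1 - ln t)) powr b \<le> (1 - ln s) powr b"
      using lt ls by (intro powr_mono2') linarith+
    moreover have "(2 * (1 - ln t)) powr b = 2 powr b * (1 - ln t) powr b"
      using lt by (subst powr_mult) auto
    ultimately have "2 powr - b * (2 powr b * (1 - ln t) powr b) \<le> 2 powr - b * (1 - ln s) powr b"
      by (intro mult_left_mono) auto
    moreover have "2 powr - b * (2 powr b * (1 - ln t) powr b) = (1 - ln t) powr b"
      by (simp add: powr_minus)
    ultimately show ?thesis using False by simp
  qed
  have "psi c b t \<le> (2 * s) powr c * (2 powr \<bar>b\<bar> * (1 - ln s) powr b)"
    unfolding psi_def by (intro mult_mono 1 2) auto
  then show ?thesis
    using s by (simp add: psi_def powr_mult powr_add mult_ac)
qed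

text \<open>For b <= 0 the logarithmic factor is itself nondecreasing on (0,1], so the power alone
  controls the ratio, with constant 1 and no loss of exponent.\<close>

lemma psi_le_nonpos:
  assumes "0 < s" "s \<le> t" "t \<le> 1" "b \<le> 0"
  shows "psi c b s \<le> (s / t) powr c * psi c b t"
proof -
  have "ln t \<le> 0" "ln s \<le> ln t" using assms by auto
  then have "(1 - ln s) powr b \<le> (1 - ln t) powr b"
    using assms by (intro powr_mono2') linarith+
  then have "s powr c * (1 - ln s) powr b \<le> s powr c * (1 - ln t) powr b"
    by (intro mult_left_mono) auto
  then show ?thesis using assms by (simp add: psi_def powr_divide)
qed

text \<open>For b > 0 the logarithmic factor increases towards 0, but more slowly than any power:
  half of the exponent c is given up to absorb it.\<close>

lemma psi_growth:
  assumes "0 < c"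
  obtains C where "0 < C"
    "\<And>s t. 0 < s \<Longrightarrow> s \<le> t \<Longrightarrow> t \<le> 1 \<Longrightarrow> psi c b s \<le> C * (s / t) powr (c / 2) * psi c b t"
proof (cases "0 < b")
  case False
  have "psi c b s \<le> 1 * (s / t) powr (c / 2) * psi c b t" if "0 < s" "s \<le> t" "t \<le> 1" for s t
  proof -
    have "psi c b s \<le> (s / t) powr c * psi c b t"
      using False that by (intro psi_le_nonpos) auto
    also have "\<dots> \<le> (s / t) powr (c / 2) * psi c b t"
      using that assms by (intro mult_right_mono powr_mono') auto
    finally show ?thesis by simp
  qed
  then show ?thesis by (intro that[of 1]) auto
next
  case True
  \<comment> \<open>Chosen so that (x^e)^b = x^(c/2) is exactly the half that is given up; C then
    comes from 1 + ln x <= (1 + 1/e) x^e.\<close>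
  define e where "e = c / (2 * b)"
  have e: "0 < e" "e * b = c / 2" using assms True by (auto simp: e_def)
  define C where "C = (1 + 1 / e) powr b"
  have "0 < 1 + 1 / e" using e by (simp add: add_pos_pos)
  then have "0 < C" by (simp add: C_def)
  moreover have "psi c b s \<le> C * (s / t) powr (c / 2) * psi c b t" if "0 < s" "s \<le> t" "t \<le> 1" for s t
  proof -
    define x where "x = t / s"
    have x: "1 \<le> x" using that by (simp add: x_def)
    have "e * ln x = ln (x powr e)" using x by (simp add: ln_powr)
    also have "\<dots> \<le> x powr e - 1" using x by (intro ln_le_minus_one) auto
    finally have "ln x \<le> x powr e / e" using e by (simp add: field_simps)
    moreover have "1 \<le> x powr e" using x e by (simp add: ge_one_powr_ge_zero)
    ultimately have lx: "1 + ln x \<le> (1 + 1 / e) * x powr e" by (simp add: algebra_simps)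
    have lt: "ln t \<le> 0" "0 \<le> ln x" using that x by auto
    have "1 - ln s = (1 - ln t) + ln x" using that by (simp add: x_def ln_div)
    \<comment> \<open>The sum becomes a product because ln t <= 0 <= ln x, which separates the
      dependence on t from that on t/s.\<close>
    also have "\<dots> \<le> (1 - ln t) * (1 + ln x)"
      using lt by (simp add: algebra_simps mult_nonpos_nonneg)
    also have "\<dots> \<le> (1 - ln t) * ((1 + 1 / e) * x powr e)"
      using lt lx by (intro mult_left_mono) auto
    finally have "(1 - ln s) powr b \<le> ((1 - ln t) * ((1 + 1 / e) * x powr e)) powr b"
      using True that lt by (intro powr_mono2) (auto intro: order_trans[of _ 0])
    also have "\<dots> = C * x powr (c / 2) * (1 - ln t) powr b"
      unfolding e(2)[symmetric] using x by (simp add: powr_mult powr_powr C_def mult_ac)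
    finally have "psi c b s \<le> s powr c * (C * x powr (c / 2) * (1 - ln t) powr b)"
      unfolding psi_def by (intro mult_left_mono) auto
    also have "s powr c * x powr (c / 2) = (s / t) powr (c / 2) * t powr c"
    proof -
      have "s powr c = s powr (c/2) * s powr (c/2)" "t powr c = t powr (c/2) * t powr (c/2)"
        by (simp_all flip: powr_add)
      then show ?thesis using that by (simp add: x_def powr_divide)
    qed
    then have "s powr c * (C * x powr (c / 2) * (1 - ln t) powr b) = C * (s / t) powr (c / 2) * psi c b t"
      by (simp add: psi_def mult_ac)
    finally show ?thesis .
  qed
  ultimately show ?thesis by (rule that)
qed

section \<open>Decreasing rearrangements\<close>

text \<open>On (t/2, t] the decreasing g is at least g(t), and by doubling the weight is at least a
  fixed fraction of its value at t. Hence a value is controlled by the integral to its left,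
  although the product of weight and g need not be monotone.\<close>

lemma quasi_monotone:
  assumes g: "antimono_on {0<..<1} g" "\<And>s. 0 < s \<Longrightarrow> 0 \<le> g s" and t: "0 < t" "t < 1" and "0 \<le> c"
  shows "ennreal (psi c b t * g t) \<le> ennreal (2 * 2 powr (c + \<bar>b\<bar>)) *
    (\<integral>\<^sup>+ s. indicator {0<..t} s * ennreal (psi c b s * g s) \<partial>dlog)"
proof -
  define D where "D = 2 powr (c + \<bar>b\<bar>)"
  define m where "m = psi c b t * g t / D"
  have D: "0 < D" by (simp add: D_def)
  have m: "0 \<le> m" using D g(2)[OF t(1)] by (simp add: m_def)
  \<comment> \<open>The mass 1/2 comes from 1/s >= 1/t on an interval of length t/2.\<close>
  have "ennreal m * ennreal (1 / 2) = (\<integral>\<^sup>+ s. ennreal (m / t) * indicator {t/2<..t} s \<partial>lborel)"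
  proof -
    have "(\<integral>\<^sup>+ s. ennreal (m / t) * indicator {t/2<..t} s \<partial>lborel) = ennreal (m / t) * ennreal (t - t / 2)"
      using t by (subst nn_integral_cmult_indicator) auto
    also have "\<dots> = ennreal (m / t * (t - t / 2))"
      using m t by (intro ennreal_mult[symmetric]) auto
    also have "m / t * (t - t / 2) = m * (1 / 2)" using t by (simp add: field_simps)
    also have "ennreal \<dots> = ennreal m * ennreal (1 / 2)"
      using m by (intro ennreal_mult) auto
    finally show ?thesis by simp
  qed
  also have "\<dots> \<le> (\<integral>\<^sup>+ s. indicator {0<..<1} s * ennreal (1 / s) * (indicator {t/2<..t} s * ennreal m) \<partial>lborel)"
    using m t
    by (intro nn_integral_mono)
       (auto simp flip: ennreal_mult split: split_indicator intro!: ennreal_leI divide_left_mono)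
  also have "\<dots> = (\<integral>\<^sup>+ s. indicator {t/2<..t} s * ennreal m \<partial>dlog)"
    by (subst nn_integral_dlog) auto
  also have "\<dots> \<le> (\<integral>\<^sup>+ s. indicator {0<..t} s * ennreal (psi c b s * g s) \<partial>dlog)"
  proof (intro nn_integral_dlog_mono)
    fix s :: real assume s: "0 < s" "s < 1"
    have "m \<le> psi c b s * g s" if "s \<le> t" "t / 2 < s"
    proof -
      have "psi c b t * g t \<le> (D * psi c b s) * g s"
        using that t s assms g(2)[OF t(1)] D unfolding D_def
        by (intro mult_mono psi_doubling) (auto simp: monotone_on_def)
      then show ?thesis using D by (simp add: m_def field_simps)
    qed
    then show "indicator {t/2<..t} s * ennreal m \<le> indicator {0<..t} s * ennreal (psi c b s * g s)"
      using s t by (auto split: split_indicator intro!: ennreal_leI)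
  qed
  finally have "ennreal (2 * D) * (ennreal m * ennreal (1 / 2))
     \<le> ennreal (2 * D) * (\<integral>\<^sup>+ s. indicator {0<..t} s * ennreal (psi c b s * g s) \<partial>dlog)"
    by (intro mult_left_mono) auto
  moreover have "ennreal (2 * D) * (ennreal m * ennreal (1 / 2)) = ennreal (psi c b t * g t)"
  proof -
    have "ennreal (psi c b t * g t) = ennreal (2 * D * (m * (1 / 2)))" using D by (simp add: m_def)
    also have "\<dots> = ennreal (2 * D) * ennreal (m * (1 / 2))" using D m by (intro ennreal_mult) auto
    also have "ennreal (m * (1 / 2)) = ennreal m * ennreal (1 / 2)" using m by (intro ennreal_mult) auto
    finally show ?thesis by simp
  qed
  ultimately show ?thesis by (simp add: D_def)
qed

text \<open>Write h^p = h^(p-1) * h, bound the first factor by (A times the integral of h)^(p-1),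
  and integrate the second.\<close>

lemma nn_integral_powr_le_self_bounded:
  fixes h :: "'a \<Rightarrow> ennreal"
  assumes [measurable]: "h \<in> borel_measurable M" and "1 \<le> p" "0 \<le> A"
    and h: "AE s in M. h s \<le> ennreal A * (\<integral>\<^sup>+ x. h x \<partial>M)"
  shows "enn_powr (\<integral>\<^sup>+ s. enn_powr (h s) p \<partial>M) (1 / p) \<le> ennreal (A powr ((p - 1) / p)) * (\<integral>\<^sup>+ s. h s \<partial>M)"
proof -
  define I where "I = (\<integral>\<^sup>+ s. h s \<partial>M)"
  have "(\<integral>\<^sup>+ s. enn_powr (h s) p \<partial>M) \<le> (\<integral>\<^sup>+ s. enn_powr (ennreal A * I) (p - 1) * h s \<partial>M)"
  proof (rule nn_integral_mono_AE, use h in eventually_elim)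
    case (elim s)
    have "enn_powr (h s) p = enn_powr (h s) (p - 1) * h s"
      using enn_powr_add[of "h s" "p - 1" 1] by simp
    then show ?case
      using elim assms by (simp add: I_def mult_right_mono enn_powr_mono)
  qed
  also have "\<dots> = enn_powr (ennreal A * I) (p - 1) * I"
    unfolding I_def by (rule nn_integral_cmult) measurable
  also have "\<dots> = ennreal (A powr (p - 1)) * enn_powr I p"
    using enn_powr_add[of I "p - 1" 1] assms by (simp add: enn_powr_mult mult.assoc)
  finally have "enn_powr (\<integral>\<^sup>+ s. enn_powr (h s) p \<partial>M) (1 / p)
      \<le> enn_powr (ennreal (A powr (p - 1)) * enn_powr I p) (1 / p)"
    using assms by (intro enn_powr_mono) auto
  also have "\<dots> = ennreal (A powr ((p - 1) / p)) * I"
    using assms by (simp add: enn_powr_mult enn_powr_powr powr_powr)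
  finally show ?thesis by (simp add: I_def)
qed

text \<open>The embedding of Lorentz spaces from second exponent 1 to second exponent p. By
  \<open>quasi_monotone\<close> the integrand is bounded by a multiple of its own integral, so the
  preceding lemma applies.\<close>

lemma weighted_Lp_le_L1:
  assumes [measurable]: "g \<in> borel_measurable borel"
    and g: "antimono_on {0<..<1} g" "\<And>s. 0 < s \<Longrightarrow> 0 \<le> g s" and "1 \<le> p" "0 \<le> c"
  shows "enn_powr (\<integral>\<^sup>+ s. indicator {0<..T} s * ennreal ((psi c b s * g s) powr p) \<partial>dlog) (1 / p)
    \<le> ennreal ((2 * 2 powr (c + \<bar>b\<bar>)) powr ((p - 1) / p)) *
       (\<integral>\<^sup>+ s. indicator {0<..T} s * ennreal (psi c b s * g s) \<partial>dlog)"
proof -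
  define h where "h = (\<lambda>s. indicator {0<..T} s * ennreal (psi c b s * g s))"
  have [measurable]: "h \<in> borel_measurable borel" unfolding h_def by measurable
  have "enn_powr (\<integral>\<^sup>+ s. enn_powr (h s) p \<partial>dlog) (1 / p)
    \<le> ennreal ((2 * 2 powr (c + \<bar>b\<bar>)) powr ((p - 1) / p)) * (\<integral>\<^sup>+ s. h s \<partial>dlog)"
  proof (rule nn_integral_powr_le_self_bounded)
    show "AE s in dlog. h s \<le> ennreal (2 * 2 powr (c + \<bar>b\<bar>)) * (\<integral>\<^sup>+ x. h x \<partial>dlog)"
    proof (rule AE_dlogI)
      fix t :: real assume t: "0 < t" "t < 1"
      show "h t \<le> ennreal (2 * 2 powr (c + \<bar>b\<bar>)) * (\<integral>\<^sup>+ x. h x \<partial>dlog)"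
      proof (cases "t \<le> T")
        case True
        have "h t = ennreal (psi c b t * g t)" using True t by (simp add: h_def)
        also have "\<dots> \<le> ennreal (2 * 2 powr (c + \<bar>b\<bar>)) *
            (\<integral>\<^sup>+ s. indicator {0<..t} s * ennreal (psi c b s * g s) \<partial>dlog)"
          by (rule quasi_monotone) (use assms t in auto)
        also have "\<dots> \<le> ennreal (2 * 2 powr (c + \<bar>b\<bar>)) * (\<integral>\<^sup>+ x. h x \<partial>dlog)"
          using True by (intro mult_left_mono nn_integral_mono) (auto simp: h_def split: split_indicator)
        finally show ?thesis .
      qed (simp add: h_def)
    qed
  qed (use assms in auto)
  moreover have "(\<integral>\<^sup>+ s. enn_powr (h s) p \<partial>dlog)
      = (\<integral>\<^sup>+ s. indicator {0<..T} s * ennreal ((psi c b s * g s) powr p) \<partial>dlog)"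
    by (intro nn_integral_dlog_cong) (auto simp: h_def g split: split_indicator)
  ultimately show ?thesis by (simp add: h_def)
qed

section \<open>Decreasing rearrangements of functions on a set of finite measure\<close>

lemma decr_rearr_le:
  "0 \<le> s \<Longrightarrow> measure (lebesgue_on \<Omega>) {x\<in>\<Omega>. s < \<bar>f x\<bar>} \<le> t \<Longrightarrow> decr_rearr \<Omega> f t \<le> s"
  unfolding decr_rearr_def by (rule cInf_lower) (auto intro: bdd_belowI[of _ 0])

context
  fixes \<Omega> :: "'n::euclidean_space set"
  assumes \<Omega>: "\<Omega> \<in> lmeasurable"
begin

lemma finite_measure_on: "finite_measure (lebesgue_on \<Omega>)"
  using \<Omega> by (rule finite_measure_lebesgue_on)

lemma level_set_measurable:
  fixes f :: "'n \<Rightarrow> real"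
  assumes "f \<in> borel_measurable (lebesgue_on \<Omega>)"
  shows "{x\<in>\<Omega>. s < \<bar>f x\<bar>} \<in> sets (lebesgue_on \<Omega>)"
proof -
  note assms [measurable]
  have "{x\<in>space (lebesgue_on \<Omega>). s < \<bar>f x\<bar>} \<in> sets (lebesgue_on \<Omega>)"
    by measurable
  then show ?thesis by simp
qed

lemma measure_level_mono:
  fixes f g :: "'n \<Rightarrow> real"
  assumes "f \<in> borel_measurable (lebesgue_on \<Omega>)" "s \<le> s'" "\<And>x. x \<in> \<Omega> \<Longrightarrow> \<bar>g x\<bar> \<le> \<bar>f x\<bar>"
  shows "measure (lebesgue_on \<Omega>) {x\<in>\<Omega>. s' < \<bar>g x\<bar>} \<le> measure (lebesgue_on \<Omega>) {x\<in>\<Omega>. s < \<bar>f x\<bar>}"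
proof (rule finite_measure.finite_measure_mono[OF finite_measure_on _ level_set_measurable[OF assms(1)]])
  show "{x\<in>\<Omega>. s' < \<bar>g x\<bar>} \<subseteq> {x\<in>\<Omega>. s < \<bar>f x\<bar>}" using assms(2,3) by force
qed

text \<open>In finite measure the level sets of a real-valued function shrink to a null set. This
  makes the infimum in \<open>decr_rearr\<close> run over a nonempty set for t > 0, and is why the
  facts below require positive arguments.\<close>

lemma ex_level_measure_le:
  fixes f :: "'n \<Rightarrow> real"
  assumes f: "f \<in> borel_measurable (lebesgue_on \<Omega>)" and "0 < t"
  shows "\<exists>s\<ge>0. measure (lebesgue_on \<Omega>) {x\<in>\<Omega>. s < \<bar>f x\<bar>} \<le> t"
proof -
  let ?A = "\<lambda>n. {x\<in>\<Omega>. real n < \<bar>f x\<bar>}"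
  have "(\<lambda>n. measure (lebesgue_on \<Omega>) (?A n)) \<longlonglongrightarrow> measure (lebesgue_on \<Omega>) (\<Inter>n. ?A n)"
    by (rule finite_measure.finite_Lim_measure_decseq[OF finite_measure_on])
       (auto intro: level_set_measurable[OF f] simp: decseq_def)
  moreover have "(\<Inter>n. ?A n) = {}"
  proof (rule equals0I)
    fix x assume "x \<in> (\<Inter>n. ?A n)"
    moreover obtain n where "\<bar>f x\<bar> < real n" using reals_Archimedean2 by blast
    ultimately show False by (auto dest!: spec[of _ n])
  qed
  ultimately have "(\<lambda>n. measure (lebesgue_on \<Omega>) (?A n)) \<longlonglongrightarrow> 0"
    by simp
  then have "\<forall>\<^sub>F n in sequentially. measure (lebesgue_on \<Omega>) (?A n) < t"
    using \<open>0 < t\<close> by (rule order_tendstoD)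
  then obtain n where "measure (lebesgue_on \<Omega>) (?A n) < t"
    by (auto simp: eventually_sequentially)
  then show ?thesis by (intro exI[of _ "real n"]) auto
qed

lemma decr_rearr_nonneg:
  fixes f :: "'n \<Rightarrow> real"
  assumes "f \<in> borel_measurable (lebesgue_on \<Omega>)" "0 < t"
  shows "0 \<le> decr_rearr \<Omega> f t"
  unfolding decr_rearr_def by (rule cInf_greatest) (use ex_level_measure_le[OF assms] in auto)

text \<open>The infimum defining the rearrangement is attained: the strict level set at the infimum
  is the increasing union of the level sets slightly higher up, each of measure at most t.\<close>

lemma measure_above_decr_rearr:
  fixes f :: "'n \<Rightarrow> real"
  assumes f: "f \<in> borel_measurable (lebesgue_on \<Omega>)" and t: "0 < t"
  shows "measure (lebesgue_on \<Omega>) {x\<in>\<Omega>. decr_rearr \<Omega> f t < \<bar>f x\<bar>} \<le> t"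
proof -
  let ?l = "decr_rearr \<Omega> f t"
  let ?A = "\<lambda>n. {x\<in>\<Omega>. ?l + 1 / real (Suc n) < \<bar>f x\<bar>}"
  have le: "measure (lebesgue_on \<Omega>) (?A n) \<le> t" for n
  proof -
    have "?l < ?l + 1 / real (Suc n)" by simp
    then obtain s where s: "0 \<le> s" "measure (lebesgue_on \<Omega>) {x\<in>\<Omega>. s < \<bar>f x\<bar>} \<le> t" "s < ?l + 1 / real (Suc n)"
      unfolding decr_rearr_def using ex_level_measure_le[OF f t]
      by (subst (asm) cInf_less_iff) (auto intro: bdd_belowI[of _ 0])
    have "measure (lebesgue_on \<Omega>) (?A n) \<le> measure (lebesgue_on \<Omega>) {x\<in>\<Omega>. s < \<bar>f x\<bar>}"
      by (rule measure_level_mono) (use f s in auto)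
    then show ?thesis using s by simp
  qed
  have "(\<lambda>n. measure (lebesgue_on \<Omega>) (?A n)) \<longlonglongrightarrow> measure (lebesgue_on \<Omega>) (\<Union>n. ?A n)"
  proof (rule finite_measure.finite_Lim_measure_incseq[OF finite_measure_on])
    show "incseq ?A"
    proof (rule incseq_SucI, safe)
      fix n x assume "?l + 1 / real (Suc n) < \<bar>f x\<bar>"
      moreover have "1 / real (Suc (Suc n)) \<le> 1 / real (Suc n)" by (simp add: frac_le)
      ultimately show "?l + 1 / real (Suc (Suc n)) < \<bar>f x\<bar>" by linarith
    qed
  qed (auto intro: level_set_measurable[OF f])
  moreover have "(\<Union>n. ?A n) = {x\<in>\<Omega>. ?l < \<bar>f x\<bar>}"
  proof safe
    fix x n assume "?l + 1 / real (Suc n) < \<bar>f x\<bar>"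
    moreover have "0 < 1 / real (Suc n)" by simp
    ultimately show "?l < \<bar>f x\<bar>" by linarith
  next
    fix x assume "x \<in> \<Omega>" "?l < \<bar>f x\<bar>"
    moreover obtain n where "1 / real (Suc n) < \<bar>f x\<bar> - ?l"
      using reals_Archimedean[of "\<bar>f x\<bar> - ?l"] \<open>?l < \<bar>f x\<bar>\<close> by (auto simp: inverse_eq_divide)
    ultimately show "x \<in> (\<Union>n. ?A n)" by (auto intro!: exI[of _ n])
  qed
  ultimately show ?thesis
    using le by (auto intro: LIMSEQ_le_const2)
qed

lemma decr_rearr_antimono:
  fixes f :: "'n \<Rightarrow> real"
  assumes "f \<in> borel_measurable (lebesgue_on \<Omega>)" "0 < s" "s \<le> t"
  shows "decr_rearr \<Omega> f t \<le> decr_rearr \<Omega> f s"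
  using decr_rearr_nonneg[of f s] measure_above_decr_rearr[of f s] assms by (intro decr_rearr_le) auto

lemma decr_rearr_mono:
  fixes f g :: "'n \<Rightarrow> real"
  assumes f: "f \<in> borel_measurable (lebesgue_on \<Omega>)" and t: "0 < t"
    and "\<And>x. x \<in> \<Omega> \<Longrightarrow> \<bar>g x\<bar> \<le> \<bar>f x\<bar>"
  shows "decr_rearr \<Omega> g t \<le> decr_rearr \<Omega> f t"
proof (rule decr_rearr_le)
  show "measure (lebesgue_on \<Omega>) {x\<in>\<Omega>. decr_rearr \<Omega> f t < \<bar>g x\<bar>} \<le> t"
    using measure_level_mono[OF f order_refl, of g "decr_rearr \<Omega> f t"] assms
      measure_above_decr_rearr[OF f t] by force
qed (rule decr_rearr_nonneg[OF f t])

text \<open>Where the sum exceeds the bound, f or g exceeds its own rearrangement, and these two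
  exceptional sets have measure at most s and t.\<close>

lemma decr_rearr_add:
  fixes f g h :: "'n \<Rightarrow> real"
  assumes f: "f \<in> borel_measurable (lebesgue_on \<Omega>)" and g: "g \<in> borel_measurable (lebesgue_on \<Omega>)"
    and st: "0 < s" "0 < t"
    and h: "\<And>x. x \<in> \<Omega> \<Longrightarrow> h x = f x + g x"
  shows "decr_rearr \<Omega> h (s + t) \<le> decr_rearr \<Omega> f s + decr_rearr \<Omega> g t"
proof (rule decr_rearr_le)
  let ?F = "{x\<in>\<Omega>. decr_rearr \<Omega> f s < \<bar>f x\<bar>}" and ?G = "{x\<in>\<Omega>. decr_rearr \<Omega> g t < \<bar>g x\<bar>}"
  have "measure (lebesgue_on \<Omega>) {x\<in>\<Omega>. decr_rearr \<Omega> f s + decr_rearr \<Omega> g t < \<bar>h x\<bar>}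
      \<le> measure (lebesgue_on \<Omega>) (?F \<union> ?G)"
    using level_set_measurable[OF f] level_set_measurable[OF g]
    by (intro finite_measure.finite_measure_mono[OF finite_measure_on]) (auto simp: h)
  also have "\<dots> \<le> measure (lebesgue_on \<Omega>) ?F + measure (lebesgue_on \<Omega>) ?G"
    by (intro measure_Un_le level_set_measurable f g)
  also have "\<dots> \<le> s + t"
    by (intro add_mono measure_above_decr_rearr f g st)
  finally show "measure (lebesgue_on \<Omega>) {x\<in>\<Omega>. decr_rearr \<Omega> f s + decr_rearr \<Omega> g t < \<bar>h x\<bar>} \<le> s + t" .
qed (intro add_nonneg_nonneg decr_rearr_nonneg f g st)

text \<open>Monotonicity on three pieces suffices. For negative arguments no level qualifies, so the
  value is the constant \<open>Inf {}\<close>; the point 0 stands alone because there too the set of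
  levels may be empty.\<close>

lemma decr_rearr_measurable:
  fixes f :: "'n \<Rightarrow> real"
  assumes f: "f \<in> borel_measurable (lebesgue_on \<Omega>)"
  shows "decr_rearr \<Omega> f \<in> borel_measurable borel"
proof -
  have neg: "decr_rearr \<Omega> f s = Inf {}" if "s < 0" for s
  proof -
    have "\<not> measure (lebesgue_on \<Omega>) A \<le> s" for A
      using measure_nonneg[of "lebesgue_on \<Omega>" A] that by linarith
    then show ?thesis by (simp add: decr_rearr_def)
  qed
  have "(\<lambda>s. - decr_rearr \<Omega> f s) \<in> borel_measurable borel"
  proof (rule borel_measurable_piecewise_mono[of "{{..<0}, {0}, {0<..}}"])
    fix c :: "real set" assume "c \<in> {{..<0}, {0}, {0<..}}"
    then show "mono_on c (\<lambda>s. - decr_rearr \<Omega> f s)"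
      by (auto simp: mono_on_def neg intro: decr_rearr_antimono[OF f])
  qed auto
  then have "(\<lambda>s. - (- decr_rearr \<Omega> f s)) \<in> borel_measurable borel"
    by (rule borel_measurable_uminus)
  then show ?thesis by simp
qed

text \<open>The part of f above height f*(t) lives on a set of measure at most t.\<close>

lemma decr_rearr_above:
  fixes f :: "'n \<Rightarrow> real"
  assumes f: "f \<in> borel_measurable (lebesgue_on \<Omega>)" and t: "0 < t" "t \<le> s"
  shows "decr_rearr \<Omega> (\<lambda>x. if decr_rearr \<Omega> f t < \<bar>f x\<bar> then f x else 0) s \<le> 0"
proof (rule decr_rearr_le)
  have eq: "{x\<in>\<Omega>. 0 < \<bar>if decr_rearr \<Omega> f t < \<bar>f x\<bar> then f x else 0\<bar>} = {x\<in>\<Omega>. decr_rearr \<Omega> f t < \<bar>f x\<bar>}"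
    using decr_rearr_nonneg[OF f t(1)] by auto
  show "measure (lebesgue_on \<Omega>) {x\<in>\<Omega>. 0 < \<bar>if decr_rearr \<Omega> f t < \<bar>f x\<bar> then f x else 0\<bar>} \<le> s"
    unfolding eq using measure_above_decr_rearr[OF f t(1)] t by simp
qed simp

lemma decr_rearr_below:
  fixes f :: "'n \<Rightarrow> real"
  assumes f: "f \<in> borel_measurable (lebesgue_on \<Omega>)" and t: "0 < t" "0 < s"
  shows "decr_rearr \<Omega> (\<lambda>x. if decr_rearr \<Omega> f t < \<bar>f x\<bar> then 0 else f x) s \<le> decr_rearr \<Omega> f t"
proof (rule decr_rearr_le)
  have eq: "{x\<in>\<Omega>. decr_rearr \<Omega> f t < \<bar>if decr_rearr \<Omega> f t < \<bar>f x\<bar> then 0 else f x\<bar>} = {}"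
    using decr_rearr_nonneg[OF f t(1)] by auto
  show "measure (lebesgue_on \<Omega>) {x\<in>\<Omega>. decr_rearr \<Omega> f t < \<bar>if decr_rearr \<Omega> f t < \<bar>f x\<bar> then 0 else f x\<bar>} \<le> s"
    unfolding eq using t by simp
qed (rule decr_rearr_nonneg[OF f t(1)])

end

section \<open>Grand and small spaces lie between Lorentz endpoints\<close>

text \<open>The antiderivative is -(1 - ln t)^b / b. This evaluates the outer weight of the small
  norm and accounts for its gain of one logarithmic power.\<close>

lemma nn_integral_dlog_log_power:
  assumes "0 < s" "s < 1" "0 < b"
  shows "(\<integral>\<^sup>+ t. indicator {s..} t * ennreal ((1 - ln t) powr (b - 1)) \<partial>dlog) = ennreal (((1 - ln s) powr b - 1) / b)"
proof -
  have pos: "0 < 1 - ln t" if "s \<le> t" "t \<le> 1" for t :: real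
    using that assms ln_le_minus_one[of t] by linarith
  have "(\<integral>\<^sup>+ t. indicator {s..} t * ennreal ((1 - ln t) powr (b - 1)) \<partial>dlog)
     = (\<integral>\<^sup>+ t. indicator {0<..<1} t * ennreal (1 / t) * (indicator {s..} t * ennreal ((1 - ln t) powr (b - 1))) \<partial>lborel)"
    by (rule nn_integral_dlog) measurable
  also have "\<dots> = (\<integral>\<^sup>+ t. ennreal ((1 - ln t) powr (b - 1) / t) * indicator {s..1} t \<partial>lborel)"
    using assms
    by (intro nn_integral_cong_AE, use AE_lborel_singleton[of "1::real"] in eventually_elim)
       (auto split: split_indicator simp flip: ennreal_mult)
  also have "\<dots> = ennreal ((- ((1 - ln 1) powr b / b)) - (- ((1 - ln s) powr b / b)))"
  proof (rule nn_integral_FTC_Icc)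
    fix t assume "t \<in> {s..1}"
    then have t: "s \<le> t" "t \<le> 1" by auto
    show "((\<lambda>t. - ((1 - ln t) powr b / b)) has_real_derivative (1 - ln t) powr (b - 1) / t) (at t)"
      using pos[OF t] t assms
      by (auto intro!: derivative_eq_intros simp: powr_diff field_simps)
    show "0 \<le> (1 - ln t) powr (b - 1) / t"
      using t assms by simp
  qed (use assms in auto)
  finally show ?thesis using assms by (simp add: diff_divide_distrib)
qed

text \<open>The rearrangement on the left is taken at t/2 because that is the form in which
  subadditivity of rearrangements delivers the two summands of a decomposition.\<close>

definition lorentz_sandwich :: "'n::euclidean_space set \<Rightarrow> real \<Rightarrow> real \<Rightarrow> (('n \<Rightarrow> real) \<Rightarrow> ennreal) \<Rightarrow> bool" where
  "lorentz_sandwich \<Omega> c b N \<longleftrightarrow> (\<exists>A>0. \<forall>f\<in>borel_measurable (lebesgue_on \<Omega>).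
     (\<forall>t. 0 < t \<longrightarrow> t < 1 \<longrightarrow> ennreal (psi c b t * decr_rearr \<Omega> f (t / 2)) \<le> ennreal A * N f) \<and>
     N f \<le> ennreal A * (\<integral>\<^sup>+ s. ennreal (psi c b s * decr_rearr \<Omega> f s) \<partial>dlog))"

lemma lorentz_sandwichI:
  assumes "0 < A" "0 < B"
    and L: "\<And>f t. f \<in> borel_measurable (lebesgue_on \<Omega>) \<Longrightarrow> 0 < t \<Longrightarrow> t < 1 \<Longrightarrow>
        ennreal (psi c b t * decr_rearr \<Omega> f (t / 2)) \<le> ennreal A * N f"
    and U: "\<And>f. f \<in> borel_measurable (lebesgue_on \<Omega>) \<Longrightarrow>
        N f \<le> ennreal B * (\<integral>\<^sup>+ s. ennreal (psi c b s * decr_rearr \<Omega> f s) \<partial>dlog)"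
  shows "lorentz_sandwich \<Omega> c b N"
  unfolding lorentz_sandwich_def
proof (intro exI[of _ "max A B"] conjI ballI allI impI)
  fix f :: "'a \<Rightarrow> real" assume f: "f \<in> borel_measurable (lebesgue_on \<Omega>)"
  { fix t :: real assume t: "0 < t" "t < 1"
    have "ennreal A * N f \<le> ennreal (max A B) * N f"
      by (intro mult_right_mono ennreal_leI) auto
    with L[OF f t] show "ennreal (psi c b t * decr_rearr \<Omega> f (t / 2)) \<le> ennreal (max A B) * N f"
      by (rule order_trans)
  }
  have "ennreal B * (\<integral>\<^sup>+ s. ennreal (psi c b s * decr_rearr \<Omega> f s) \<partial>dlog)
    \<le> ennreal (max A B) * (\<integral>\<^sup>+ s. ennreal (psi c b s * decr_rearr \<Omega> f s) \<partial>dlog)"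
    by (intro mult_right_mono ennreal_leI) auto
  with U[OF f] show "N f \<le> ennreal (max A B) * (\<integral>\<^sup>+ s. ennreal (psi c b s * decr_rearr \<Omega> f s) \<partial>dlog)"
    by (rule order_trans)
qed (use assms in auto)

text \<open>Only the interval (u, v] is kept; its length to the power 1/p becomes the power factor
  of the fundamental function.\<close>

lemma enn_powr_nn_integral_const_le:
  assumes "1 \<le> p" "0 \<le> z" "u \<le> v" and "\<And>s. u < s \<Longrightarrow> s \<le> v \<Longrightarrow> ennreal (z powr p) \<le> h s"
  shows "ennreal ((v - u) powr (1 / p) * z) \<le> enn_powr (\<integral>\<^sup>+ s. h s \<partial>lborel) (1 / p)"
proof -
  have "ennreal ((v - u) * z powr p) = (\<integral>\<^sup>+ s. ennreal (z powr p) * indicator {u<..v} s \<partial>lborel)"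
    using assms(1-3) by (subst nn_integral_cmult_indicator) (auto simp: ennreal_mult mult.commute)
  also have "\<dots> \<le> (\<integral>\<^sup>+ s. h s \<partial>lborel)"
    by (intro nn_integral_mono) (auto simp: assms split: split_indicator)
  finally have "enn_powr (ennreal ((v - u) * z powr p)) (1 / p) \<le> enn_powr (\<integral>\<^sup>+ s. h s \<partial>lborel) (1 / p)"
    using assms by (intro enn_powr_mono) auto
  moreover have "((v - u) * z powr p) powr (1 / p) = (v - u) powr (1 / p) * z"
    using assms by (simp add: powr_mult powr_powr)
  ultimately show ?thesis
    using assms by simp
qed

text \<open>From below, evaluate the supremum at t/4 and keep only (t/4, t/2], where f* is at least
  f*(t/2). From above, move the logarithmic weight inside the integral, which gives a weighted L^p
  norm independent of t, and apply \<open>weighted_Lp_le_L1\<close>.\<close>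

lemma lorentz_sandwich_grand:
  fixes \<Omega> :: "'n::euclidean_space set"
  assumes \<Omega>: "\<Omega> \<in> lmeasurable" and p: "1 < p" and \<alpha>: "0 < \<alpha>"
  shows "lorentz_sandwich \<Omega> (1 / p) (- \<alpha> / p) (grand_norm \<Omega> p \<alpha>)"
proof -
  define D where "D = 2 powr (1 / p + \<bar>- \<alpha> / p\<bar>)"
  have D: "0 < D" by (simp add: D_def)
  show ?thesis
  proof (rule lorentz_sandwichI)
    fix f :: "'n \<Rightarrow> real" and t :: real
    assume f: "f \<in> borel_measurable (lebesgue_on \<Omega>)" and t: "0 < t" "t < 1"
    let ?g = "decr_rearr \<Omega> f"
    have g0: "0 \<le> ?g (t / 2)" using decr_rearr_nonneg[OF \<Omega> f] t by simp
    \<comment> \<open>Doubling twice moves the weight to t/4, which is both the length of (t/4, t/2]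
      and the argument of the logarithm in the supremum.\<close>
    have "psi (1 / p) (- \<alpha> / p) t \<le> D * (D * psi (1 / p) (- \<alpha> / p) (t / 4))"
      using psi_doubling[of t "t/2" "1/p" "- \<alpha> / p"] psi_doubling[of "t/2" "t/4" "1/p" "- \<alpha> / p"] t p D
      unfolding D_def[symmetric] by (auto intro: order_trans mult_left_mono)
    then have "ennreal (psi (1 / p) (- \<alpha> / p) t * ?g (t / 2)) \<le> ennreal (D * D * (psi (1 / p) (- \<alpha> / p) (t / 4) * ?g (t / 2)))"
      using g0 by (intro ennreal_leI) (metis mult.assoc mult_right_mono)
    also have "\<dots> = ennreal (D * D) * ennreal (psi (1 / p) (- \<alpha> / p) (t / 4) * ?g (t / 2))"
      using D g0 by (intro ennreal_mult) auto
    also have "ennreal (psi (1 / p) (- \<alpha> / p) (t / 4) * ?g (t / 2))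
      = ennreal ((1 - ln (t / 4)) powr (- \<alpha> / p)) * ennreal ((t / 2 - t / 4) powr (1 / p) * ?g (t / 2))"
      using g0 by (subst ennreal_mult[symmetric]) (auto simp: psi_def mult_ac)
    also have "\<dots> \<le> ennreal ((1 - ln (t / 4)) powr (- \<alpha> / p)) *
        enn_powr (\<integral>\<^sup>+ s. indicator {t/4..1} s * ennreal (?g s powr p) \<partial>lborel) (1 / p)"
    proof (intro mult_left_mono enn_powr_nn_integral_const_le)
      fix s assume "t / 4 < s" "s \<le> t / 2"
      then show "ennreal (?g (t / 2) powr p) \<le> indicator {t/4..1} s * ennreal (?g s powr p)"
        using t p g0 decr_rearr_antimono[OF \<Omega> f, of s "t / 2"]
        by (auto intro!: ennreal_leI powr_mono2)
    qed (use t p g0 in auto)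
    also have "\<dots> \<le> grand_norm \<Omega> p \<alpha> f"
      unfolding grand_norm_def using t by (intro SUP_upper) auto
    finally show "ennreal (psi (1 / p) (- \<alpha> / p) t * ?g (t / 2)) \<le> ennreal (D * D) * grand_norm \<Omega> p \<alpha> f"
      by (simp add: mult_left_mono)
  next
    fix f :: "'n \<Rightarrow> real" assume f: "f \<in> borel_measurable (lebesgue_on \<Omega>)"
    let ?g = "decr_rearr \<Omega> f"
    have [measurable]: "?g \<in> borel_measurable borel" by (rule decr_rearr_measurable[OF \<Omega> f])
    show "grand_norm \<Omega> p \<alpha> f
      \<le> ennreal ((2 * 2 powr (1 / p + \<bar>- \<alpha> / p\<bar>)) powr ((p - 1) / p)) * (\<integral>\<^sup>+ s. ennreal (psi (1 / p) (- \<alpha> / p) s * ?g s) \<partial>dlog)"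
      unfolding grand_norm_def
    proof (rule SUP_least)
      fix t :: real assume "t \<in> {0<..<1}"
      then have t: "0 < t" "t < 1" by auto
      have Lt: "0 < 1 - ln s" if "0 < s" "s \<le> 1" for s :: real using ln_le_minus_one[of s] that by linarith
      have "ennreal ((1 - ln t) powr (- \<alpha> / p)) = enn_powr (ennreal ((1 - ln t) powr - \<alpha>)) (1 / p)"
        by (simp add: powr_powr)
      then have "ennreal ((1 - ln t) powr (- \<alpha> / p)) * enn_powr (\<integral>\<^sup>+ s. indicator {t..1} s * ennreal (?g s powr p) \<partial>lborel) (1 / p)
         = enn_powr (ennreal ((1 - ln t) powr - \<alpha>) * (\<integral>\<^sup>+ s. indicator {t..1} s * ennreal (?g s powr p) \<partial>lborel)) (1 / p)"
        by (simp add: enn_powr_mult)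
      also have "ennreal ((1 - ln t) powr - \<alpha>) * (\<integral>\<^sup>+ s. indicator {t..1} s * ennreal (?g s powr p) \<partial>lborel)
         = (\<integral>\<^sup>+ s. ennreal ((1 - ln t) powr - \<alpha>) * (indicator {t..1} s * ennreal (?g s powr p)) \<partial>lborel)"
        by (rule nn_integral_cmult[symmetric]) measurable
      also have "enn_powr \<dots> (1 / p) \<le> enn_powr (\<integral>\<^sup>+ s. indicator {0<..1} s * ennreal ((psi (1 / p) (- \<alpha> / p) s * ?g s) powr p) \<partial>dlog) (1 / p)"
      proof (rule enn_powr_mono)
        have "(\<integral>\<^sup>+ s. ennreal ((1 - ln t) powr - \<alpha>) * (indicator {t..1} s * ennreal (?g s powr p)) \<partial>lborel)
          \<le> (\<integral>\<^sup>+ s. indicator {0<..<1} s * ennreal (1 / s) *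
                (indicator {0<..1} s * ennreal ((psi (1 / p) (- \<alpha> / p) s * ?g s) powr p)) \<partial>lborel)"
        proof (rule nn_integral_mono_AE, use AE_lborel_singleton[of "1::real"] in eventually_elim)
          case (elim s)
          have "(1 - ln t) powr - \<alpha> * ?g s powr p \<le> (1 / s) * (psi (1 / p) (- \<alpha> / p) s * ?g s) powr p"
            if s: "t \<le> s" "s < 1"
          proof -
            have "(psi (1 / p) (- \<alpha> / p) s * ?g s) powr p = s * (1 - ln s) powr - \<alpha> * ?g s powr p"
              using p t s decr_rearr_nonneg[OF \<Omega> f, of s] by (simp add: powr_mult psi_powr) (simp add: psi_def)
            \<comment> \<open>For s >= t the base 1 - ln s is the smaller one and the exponent is
              negative, so the weight at t may be replaced by the weight at s.\<close>
            moreover have "(1 - ln t) powr - \<alpha> \<le> (1 - ln s) powr - \<alpha>"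
              using t s \<alpha> Lt[of s] by (intro powr_mono2') auto
            ultimately show ?thesis using t s by (simp add: mult_right_mono)
          qed
          then show ?case
            using elim t by (auto split: split_indicator simp flip: ennreal_mult intro!: ennreal_leI)
        qed
        also have "\<dots> = (\<integral>\<^sup>+ s. indicator {0<..1} s * ennreal ((psi (1 / p) (- \<alpha> / p) s * ?g s) powr p) \<partial>dlog)"
          by (rule nn_integral_dlog[symmetric]) measurable
        finally show "(\<integral>\<^sup>+ s. ennreal ((1 - ln t) powr - \<alpha>) * (indicator {t..1} s * ennreal (?g s powr p)) \<partial>lborel) \<le> \<dots>" .
      qed (use p in auto)
      also have "\<dots> \<le> ennreal ((2 * 2 powr (1 / p + \<bar>- \<alpha> / p\<bar>)) powr ((p - 1) / p)) *
          (\<integral>\<^sup>+ s. indicator {0<..1} s * ennreal (psi (1 / p) (- \<alpha> / p) s * ?g s) \<partial>dlog)"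
        using p decr_rearr_antimono[OF \<Omega> f] decr_rearr_nonneg[OF \<Omega> f]
        by (intro weighted_Lp_le_L1) (auto simp: monotone_on_def)
      also have "(\<integral>\<^sup>+ s. indicator {0<..1} s * ennreal (psi (1 / p) (- \<alpha> / p) s * ?g s) \<partial>dlog)
          = (\<integral>\<^sup>+ s. ennreal (psi (1 / p) (- \<alpha> / p) s * ?g s) \<partial>dlog)"
        by (rule nn_integral_dlog_cong) auto
      finally show "ennreal ((1 - ln t) powr (- \<alpha> / p)) * enn_powr (\<integral>\<^sup>+ s. indicator {t..1} s * ennreal (?g s powr p) \<partial>lborel) (1 / p)
         \<le> ennreal ((2 * 2 powr (1 / p + \<bar>- \<alpha> / p\<bar>)) powr ((p - 1) / p)) * (\<integral>\<^sup>+ s. ennreal (psi (1 / p) (- \<alpha> / p) s * ?g s) \<partial>dlog)" .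
    qed
  qed (use D in auto)
qed

text \<open>From below, for s >= t/2 the inner norm is at least (t/2)^(1/p) f*(t/2), and the outer
  weight integrates to a multiple of (1 - ln(t/2))^b. From above, replace the inner L^p norm by an
  integral against ds/s and exchange the integrals.\<close>

lemma lorentz_sandwich_small:
  fixes \<Omega> :: "'n::euclidean_space set"
  assumes \<Omega>: "\<Omega> \<in> lmeasurable" and p: "1 < p" and \<alpha>: "0 < \<alpha>"
  shows "lorentz_sandwich \<Omega> (1 / p) (- \<alpha> / p + \<alpha>) (small_norm \<Omega> p \<alpha>)"
proof -
  define b where "b = - \<alpha> / p + \<alpha>"
  have b: "0 < b" using p \<alpha> by (simp add: b_def field_simps)
  define D where "D = 2 powr (1 / p + \<bar>b\<bar>)"
  have D: "0 < D" by (simp add: D_def)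
  \<comment> \<open>With L = 1 - ln(t/2) >= 1 + ln 2, this is the constant in (L^b - 1)/b >= e *
    L^b. It is positive because t/2 stays away from 1.\<close>
  define e where "e = (1 - (1 + ln 2) powr - b) / b"
  have "(1 + ln 2 :: real) powr - b < 1 powr - b"
    using b by (intro powr_less_mono2_neg) auto
  then have e: "0 < e" using b by (simp add: e_def)
  \<comment> \<open>The constant of \<open>weighted_Lp_le_L1\<close> for the weight without
    logarithm.\<close>
  define E where "E = (2 * 2 powr (1 / p + \<bar>0\<bar>)) powr ((p - 1) / p)"
  have E: "0 < E" by (simp add: E_def)
  have small: "small_norm \<Omega> p \<alpha> f = (\<integral>\<^sup>+ t. indicator {0<..<1} t * ennreal ((1 - ln t) powr (b - 1) / t) *
        enn_powr (\<integral>\<^sup>+ s. indicator {0..t} s * ennreal (decr_rearr \<Omega> f s powr p) \<partial>lborel) (1 / p) \<partial>lborel)" for f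
    by (simp add: small_norm_def b_def)
  have "lorentz_sandwich \<Omega> (1 / p) b (small_norm \<Omega> p \<alpha>)"
  proof (rule lorentz_sandwichI)
    fix f :: "'n \<Rightarrow> real" and t :: real
    assume f: "f \<in> borel_measurable (lebesgue_on \<Omega>)" and t: "0 < t" "t < 1"
    let ?g = "decr_rearr \<Omega> f"
    have g0: "0 \<le> ?g (t / 2)" using decr_rearr_nonneg[OF \<Omega> f] t by simp
    define y where "y = (t / 2) powr (1 / p) * ?g (t / 2)"
    have y: "0 \<le> y" using g0 by (simp add: y_def)
    have "ln (t / 2) \<le> - ln 2" using t by (simp add: ln_div)
    then have "(1 + ln 2) powr b \<le> (1 - ln (t / 2)) powr b"
      using b by (intro powr_mono2) auto
    moreover have "0 < (1 + ln 2 :: real) powr b"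
    proof -
      have "0 < ln (2 :: real)" by simp
      then have "1 + ln (2 :: real) \<noteq> 0" by linarith
      then show ?thesis by simp
    qed
    ultimately have "1 \<le> (1 + ln 2) powr - b * (1 - ln (t / 2)) powr b"
      by (simp add: powr_minus field_simps)
    then have el: "e * (1 - ln (t / 2)) powr b \<le> ((1 - ln (t / 2)) powr b - 1) / b"
      using b by (simp add: e_def field_simps)
    have "psi (1 / p) b t \<le> D * psi (1 / p) b (t / 2)"
      unfolding D_def by (intro psi_doubling) (use t p in auto)
    then have "psi (1 / p) b t * ?g (t / 2) \<le> D * psi (1 / p) b (t / 2) * ?g (t / 2)"
      using g0 by (intro mult_right_mono) auto
    also have "\<dots> = (D / e) * (e * (1 - ln (t / 2)) powr b * y)"
      using e by (simp add: psi_def y_def)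
    also have "\<dots> \<le> (D / e) * (((1 - ln (t / 2)) powr b - 1) / b * y)"
      using D e y el by (intro mult_left_mono mult_right_mono) auto
    finally have "ennreal (psi (1 / p) b t * ?g (t / 2)) \<le> ennreal ((D / e) * (((1 - ln (t / 2)) powr b - 1) / b * y))"
      by (rule ennreal_leI)
    also have "\<dots> = ennreal (D / e) * (ennreal (((1 - ln (t / 2)) powr b - 1) / b) * ennreal y)"
    proof -
      have mult: "ennreal (x * (z * y)) = ennreal x * (ennreal z * ennreal y)" if "0 \<le> x" "0 \<le> z" for x z
        using that y by (simp add: ennreal_mult)
      show ?thesis
        by (intro mult order_trans[OF _ el]) (use D e in auto)
    qed
    also have "ennreal (((1 - ln (t / 2)) powr b - 1) / b) * ennreal y
      = (\<integral>\<^sup>+ s. indicator {t/2..} s * ennreal ((1 - ln s) powr (b - 1)) * ennreal y \<partial>dlog)"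
      using t b by (subst nn_integral_dlog_log_power[symmetric]) (auto intro!: nn_integral_multc[symmetric])
    also have "\<dots> = (\<integral>\<^sup>+ s. indicator {0<..<1} s * ennreal (1 / s) * (indicator {t/2..} s * ennreal ((1 - ln s) powr (b - 1)) * ennreal y) \<partial>lborel)"
      by (rule nn_integral_dlog) measurable
    also have "\<dots> \<le> small_norm \<Omega> p \<alpha> f"
      unfolding small
    proof (intro nn_integral_mono)
      fix s :: real
      have "ennreal (((t / 2) - 0) powr (1 / p) * ?g (t / 2))
          \<le> enn_powr (\<integral>\<^sup>+ x. indicator {0..s} x * ennreal (?g x powr p) \<partial>lborel) (1 / p)" if "t / 2 \<le> s"
      proof (rule enn_powr_nn_integral_const_le)
        fix x assume "0 < x" "x \<le> t / 2"
        then show "ennreal (?g (t / 2) powr p) \<le> indicator {0..s} x * ennreal (?g x powr p)"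
          using t p g0 that decr_rearr_antimono[OF \<Omega> f, of x "t / 2"]
          by (auto intro!: ennreal_leI powr_mono2)
      qed (use t p g0 in auto)
      then show "indicator {0<..<1} s * ennreal (1 / s) * (indicator {t/2..} s * ennreal ((1 - ln s) powr (b - 1)) * ennreal y)
        \<le> indicator {0<..<1} s * ennreal ((1 - ln s) powr (b - 1) / s) *
            enn_powr (\<integral>\<^sup>+ x. indicator {0..s} x * ennreal (?g x powr p) \<partial>lborel) (1 / p)"
        by (auto split: split_indicator simp: y_def mult_left_mono simp flip: mult.assoc ennreal_mult)
    qed
    finally show "ennreal (psi (1 / p) b t * ?g (t / 2)) \<le> ennreal (D / e) * small_norm \<Omega> p \<alpha> f"
      by (simp add: mult_left_mono)
  next
    fix f :: "'n \<Rightarrow> real" assume f: "f \<in> borel_measurable (lebesgue_on \<Omega>)"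
    let ?g = "decr_rearr \<Omega> f"
    have [measurable]: "?g \<in> borel_measurable borel" by (rule decr_rearr_measurable[OF \<Omega> f])
    interpret sigma_finite_measure dlog by (rule sigma_finite_dlog)
    interpret pair_sigma_finite dlog dlog ..
    define h where "h = (\<lambda>s. ennreal (s powr (1 / p) * ?g s))"
    have [measurable]: "h \<in> borel_measurable borel" unfolding h_def by measurable
    have inner: "enn_powr (\<integral>\<^sup>+ s. indicator {0..t} s * ennreal (?g s powr p) \<partial>lborel) (1 / p)
        \<le> ennreal E * (\<integral>\<^sup>+ s. indicator {0<..t} s * h s \<partial>dlog)" if t: "0 < t" "t < 1" for t
    proof -
      have "(\<integral>\<^sup>+ s. indicator {0..t} s * ennreal (?g s powr p) \<partial>lborel)
          \<le> (\<integral>\<^sup>+ s. indicator {0<..<1} s * ennreal (1 / s) * (indicator {0<..t} s * ennreal ((psi (1 / p) 0 s * ?g s) powr p)) \<partial>lborel)"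
      proof (rule nn_integral_mono_AE, use AE_lborel_singleton[of "0::real"] in eventually_elim)
        case (elim s)
        have "(psi (1 / p) 0 s * ?g s) powr p = s * ?g s powr p" if "0 < s" "s < 1"
          using p that decr_rearr_nonneg[OF \<Omega> f, of s] ln_le_minus_one[of s] by (simp add: powr_mult psi_powr) (simp add: psi_def)
        then show ?case
          using elim t by (auto split: split_indicator simp flip: ennreal_mult)
      qed
      also have "\<dots> = (\<integral>\<^sup>+ s. indicator {0<..t} s * ennreal ((psi (1 / p) 0 s * ?g s) powr p) \<partial>dlog)"
        by (rule nn_integral_dlog[symmetric]) measurable
      finally have "enn_powr (\<integral>\<^sup>+ s. indicator {0..t} s * ennreal (?g s powr p) \<partial>lborel) (1 / p)
          \<le> enn_powr \<dots> (1 / p)"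
        using p by (intro enn_powr_mono) auto
      also have "\<dots> \<le> ennreal E * (\<integral>\<^sup>+ s. indicator {0<..t} s * ennreal (psi (1 / p) 0 s * ?g s) \<partial>dlog)"
        unfolding E_def using p decr_rearr_antimono[OF \<Omega> f] decr_rearr_nonneg[OF \<Omega> f]
        by (intro weighted_Lp_le_L1) (auto simp: monotone_on_def)
      also have "(\<integral>\<^sup>+ s. indicator {0<..t} s * ennreal (psi (1 / p) 0 s * ?g s) \<partial>dlog)
          = (\<integral>\<^sup>+ s. indicator {0<..t} s * h s \<partial>dlog)"
      proof (rule nn_integral_dlog_cong)
        fix s :: real assume "0 < s" "s < 1"
        then show "indicator {0<..t} s * ennreal (psi (1 / p) 0 s * ?g s) = indicator {0<..t} s * h s"
          using ln_le_minus_one[of s] by (simp add: psi_def h_def)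
      qed
      finally show ?thesis .
    qed
    \<comment> \<open>The condition 0 < s <= t is written with \<open>if\<close> so that the
      integrand is visibly measurable in both variables jointly, as Fubini requires.\<close>
    have meas: "(\<lambda>(s, t). ennreal ((1 - ln t) powr (b - 1)) * (ennreal E * ((if 0 < s \<and> s \<le> t then 1 else 0) * h s)))
        \<in> borel_measurable (dlog \<Otimes>\<^sub>M dlog)"
      by measurable
    have "small_norm \<Omega> p \<alpha> f \<le> (\<integral>\<^sup>+ t. indicator {0<..<1} t * ennreal (1 / t) *
       (ennreal ((1 - ln t) powr (b - 1)) * (ennreal E * (\<integral>\<^sup>+ s. (if 0 < s \<and> s \<le> t then 1 else 0) * h s \<partial>dlog))) \<partial>lborel)"
      unfolding small
    proof (intro nn_integral_mono)
      fix t :: real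
      have ind: "(\<integral>\<^sup>+ s. (if 0 < s \<and> s \<le> t then 1 else 0) * h s \<partial>dlog) = (\<integral>\<^sup>+ s. indicator {0<..t} s * h s \<partial>dlog)"
        by (intro nn_integral_cong) auto
      show "indicator {0<..<1} t * ennreal ((1 - ln t) powr (b - 1) / t) *
          enn_powr (\<integral>\<^sup>+ s. indicator {0..t} s * ennreal (?g s powr p) \<partial>lborel) (1 / p)
        \<le> indicator {0<..<1} t * ennreal (1 / t) *
       (ennreal ((1 - ln t) powr (b - 1)) * (ennreal E * (\<integral>\<^sup>+ s. (if 0 < s \<and> s \<le> t then 1 else 0) * h s \<partial>dlog)))"
      proof (cases "0 < t \<and> t < 1")
        case True
        have "ennreal ((1 - ln t) powr (b - 1) / t) = ennreal (1 / t) * ennreal ((1 - ln t) powr (b - 1))"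
          using True by (simp flip: ennreal_mult)
        then show ?thesis
          using True mult_left_mono[OF inner[of t], of "ennreal (1 / t) * ennreal ((1 - ln t) powr (b - 1))"]
          unfolding ind by (simp add: mult.assoc)
      qed auto
    qed
    also have "\<dots> = (\<integral>\<^sup>+ t. ennreal ((1 - ln t) powr (b - 1)) * (ennreal E * (\<integral>\<^sup>+ s. (if 0 < s \<and> s \<le> t then 1 else 0) * h s \<partial>dlog)) \<partial>dlog)"
      by (rule nn_integral_dlog[symmetric]) measurable
    also have "\<dots> = (\<integral>\<^sup>+ t. \<integral>\<^sup>+ s. ennreal ((1 - ln t) powr (b - 1)) * (ennreal E * ((if 0 < s \<and> s \<le> t then 1 else 0) * h s)) \<partial>dlog \<partial>dlog)"
      by (simp add: nn_integral_cmult)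
    \<comment> \<open>After the exchange t runs over [s, 1), and the outer weight can be integrated
      explicitly for each fixed s.\<close>
    also have "\<dots> = (\<integral>\<^sup>+ s. \<integral>\<^sup>+ t. ennreal ((1 - ln t) powr (b - 1)) * (ennreal E * ((if 0 < s \<and> s \<le> t then 1 else 0) * h s)) \<partial>dlog \<partial>dlog)"
      by (rule Fubini'[OF meas])
    also have "\<dots> \<le> (\<integral>\<^sup>+ s. ennreal (E / b) * ennreal (psi (1 / p) b s * ?g s) \<partial>dlog)"
    proof (intro nn_integral_dlog_mono)
      fix s :: real assume s: "0 < s" "s < 1"
      have g0: "0 \<le> ?g s" using decr_rearr_nonneg[OF \<Omega> f] s by simp
      have "(\<integral>\<^sup>+ t. ennreal ((1 - ln t) powr (b - 1)) * (ennreal E * ((if 0 < s \<and> s \<le> t then 1 else 0) * h s)) \<partial>dlog)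
         = (\<integral>\<^sup>+ t. (ennreal E * h s) * (indicator {s..} t * ennreal ((1 - ln t) powr (b - 1))) \<partial>dlog)"
        using s by (intro nn_integral_cong) (auto split: split_indicator simp: mult_ac)
      also have "\<dots> = (ennreal E * h s) * ennreal (((1 - ln s) powr b - 1) / b)"
        using s b by (subst nn_integral_cmult) (auto simp: nn_integral_dlog_log_power)
      also have "\<dots> \<le> (ennreal E * h s) * ennreal ((1 - ln s) powr b / b)"
        using b by (intro mult_left_mono ennreal_leI divide_right_mono) auto
      also have "\<dots> = ennreal (E / b) * ennreal (psi (1 / p) b s * ?g s)"
        using E b g0 by (simp add: h_def psi_def mult_ac flip: ennreal_mult)
      finally show "(\<integral>\<^sup>+ t. ennreal ((1 - ln t) powr (b - 1)) * (ennreal E * ((if 0 < s \<and> s \<le> t then 1 else 0) * h s)) \<partial>dlog)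
         \<le> ennreal (E / b) * ennreal (psi (1 / p) b s * ?g s)" .
    qed
    also have "\<dots> = ennreal (E / b) * (\<integral>\<^sup>+ s. ennreal (psi (1 / p) b s * ?g s) \<partial>dlog)"
      by (rule nn_integral_cmult) measurable
    finally show "small_norm \<Omega> p \<alpha> f \<le> ennreal (E / b) * (\<integral>\<^sup>+ s. ennreal (psi (1 / p) b s * ?g s) \<partial>dlog)" .
  qed (use D E b e in auto)
  then show ?thesis by (simp add: b_def)
qed

section \<open>Change of variables in the interpolation norm\<close>

text \<open>Superlevel sets of a monotone function are intervals. This serves the K-functional, an
  infimum over decompositions whose measurability in t is obtained from monotonicity.\<close>

lemma borel_measurable_mono_ennreal:
  fixes K :: "real \<Rightarrow> ennreal"
  assumes "mono K"
  shows "K \<in> borel_measurable borel"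
proof (rule borel_measurableI_greater)
  fix y
  have "is_interval {x \<in> space borel. y < K x}"
    using assms by (auto simp: is_interval_1 mono_def intro: less_le_trans)
  then show "{x \<in> space borel. y < K x} \<in> sets borel"
    by (rule real_interval_borel_measurable)
qed

lemma psi_le_powr:
  assumes "0 < t" "t \<le> 1" "b \<le> 0"
  shows "psi c b t \<le> t powr c"
  using psi_le_nonpos[of t 1 b c] assms by (simp add: psi_def)

text \<open>The derivative is factored so that u = psi c b t gives du/u = (c - b/(1 - ln t))
  dt/t.\<close>

lemma psi_has_derivative:
  assumes "0 < t" "t \<le> 1"
  shows "(psi c b has_real_derivative psi c b t / t * (c - b / (1 - ln t))) (at t)"
proof -
  have "0 < 1 - ln t" using ln_le_minus_one[of t] assms by linarith
  then show ?thesis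
    unfolding psi_def using assms
    by (auto intro!: derivative_eq_intros simp: powr_diff field_simps)
qed

text \<open>For c > 0 and b <= 0 the weight maps (0,1] increasingly onto (0,1]. Substitution is
  carried out on compact intervals ending at 1, which then exhaust (0,1] by monotone limits of
  measures.\<close>

lemma nn_integral_dlog_substitution:
  fixes F :: "real \<Rightarrow> ennreal"
  assumes [measurable]: "F \<in> borel_measurable borel" and c: "0 < c" and b: "b \<le> 0"
  shows "(\<integral>\<^sup>+ u. F u \<partial>dlog) = (\<integral>\<^sup>+ t. F (psi c b t) * ennreal (c - b / (1 - ln t)) \<partial>dlog)"
proof -
  let ?f = "\<lambda>u. indicator {0<..<1} u * ennreal (1 / u) * F u"
  let ?d = "\<lambda>t. psi c b t / t * (c - b / (1 - ln t))"
  let ?a = "\<lambda>n. 1 / (real n + 2)"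
  have L: "0 < 1 - ln t" if "0 < t" "t \<le> 1" for t :: real
    using ln_le_minus_one[of t] that by linarith
  have d: "0 \<le> ?d t" if "0 < t" "t \<le> 1" for t
    using L[OF that] b c that by (auto intro!: mult_nonneg_nonneg simp: divide_nonpos_pos order_trans[of _ 0])
  have a: "0 < ?a n" "?a n < 1" for n by auto
  have eq: "emeasure (density lborel ?f) {psi c b (?a n)..1} = emeasure (density lborel (\<lambda>t. ?f (psi c b t) * ennreal (?d t))) {?a n..1}" for n
  proof -
    have "(\<integral>\<^sup>+ x. ?f x * indicator {psi c b (?a n)..psi c b 1} x \<partial>lborel)
       = (\<integral>\<^sup>+ x. ?f (psi c b x) * ?d x * indicator {?a n..1} x \<partial>lborel)"
    proof (rule nn_integral_substitution_aux)
      fix x assume "x \<in> {?a n..1}"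
      then have ax: "?a n \<le> x" and x1: "x \<le> 1" by simp_all
      note x = less_le_trans[OF a(1) ax] x1
      show "(psi c b has_real_derivative ?d x) (at x)" by (rule psi_has_derivative[OF x])
      show "0 \<le> ?d x" by (rule d[OF x])
    next
      show "continuous_on {?a n..1} ?d"
      proof -
        have "x \<noteq> 0 \<and> 1 - ln x \<noteq> 0" if "x \<in> {?a n..1}" for x
        proof -
          have ax: "?a n \<le> x" and "x \<le> 1" using that by simp_all
          have "0 < x" by (rule less_le_trans[OF a(1) ax])
          with L[OF this \<open>x \<le> 1\<close>] show ?thesis by linarith
        qed
        then have nz: "\<forall>x\<in>{?a n..1}. x \<noteq> 0" "\<forall>x\<in>{?a n..1}. 1 - ln x \<noteq> 0"
          by blast+
        show ?thesis unfolding psi_def by (intro continuous_intros) (rule nz)+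
      qed
    qed (use a in auto)
    then show ?thesis by (simp add: emeasure_density psi_def)
  qed
  have incr: "psi c b s \<le> psi c b t" if "0 < s" "s \<le> t" "t \<le> 1" for s t
  proof -
    have "psi c b s \<le> (s / t) powr c * psi c b t" using that b by (rule psi_le_nonpos)
    also have "\<dots> \<le> 1 * psi c b t"
      using that c by (intro mult_right_mono) (auto intro!: powr_le1)
    finally show ?thesis by simp
  qed
  have dec: "?a n \<le> ?a m" if "m \<le> n" for m n using that by (simp add: frac_le)
  have small: "\<exists>n. ?a n \<le> x" if "0 < x" for x
  proof -
    obtain n where "inverse (real (Suc n)) < x" using reals_Archimedean[OF \<open>0 < x\<close>] by blast
    moreover have "?a n \<le> inverse (real (Suc n))" by (simp add: field_simps)
    ultimately show ?thesis by (intro exI[of _ n]) linarith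
  qed
  have U1: "(\<Union>n. {?a n..1}) = {0<..1}"
  proof (intro equalityI subsetI)
    fix u assume "u \<in> (\<Union>n. {?a n..1})"
    then obtain n where "?a n \<le> u" "u \<le> 1" by auto
    then show "u \<in> {0<..1}" using less_le_trans[OF a(1)] by auto
  next
    fix u :: real assume "u \<in> {0<..1}"
    with small[of u] show "u \<in> (\<Union>n. {?a n..1})" by auto
  qed
  have U2: "(\<Union>n. {psi c b (?a n)..1}) = {0<..1}"
  proof (intro equalityI subsetI)
    fix u assume "u \<in> (\<Union>n. {psi c b (?a n)..1})"
    then obtain n where "psi c b (?a n) \<le> u" "u \<le> 1" by auto
    moreover have "0 < psi c b (?a n)" using a[of n] by (intro psi_pos) auto
    ultimately show "u \<in> {0<..1}" by simp
  next
    fix u :: real assume "u \<in> {0<..1}"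
    then have u: "0 < u" "u \<le> 1" by auto
    obtain n where n: "?a n \<le> u powr (1 / c)" using small[of "u powr (1 / c)"] u by auto
    \<comment> \<open>Comparison with the pure power shows that the left end points of the image
      intervals tend to 0, so every u in (0,1] is reached.\<close>
    have "psi c b (?a n) \<le> ?a n powr c" using a[of n] b by (intro psi_le_powr) auto
    also have "\<dots> \<le> (u powr (1 / c)) powr c" using n c by (intro powr_mono2) auto
    also have "\<dots> = u" using u c by (simp add: powr_powr)
    finally show "u \<in> (\<Union>n. {psi c b (?a n)..1})" using u by auto
  qed
  have "(\<integral>\<^sup>+ u. F u \<partial>dlog) = (\<integral>\<^sup>+ u. ?f u \<partial>lborel)"
    by (rule nn_integral_dlog) measurable
  also have "\<dots> = emeasure (density lborel ?f) (\<Union>n. {psi c b (?a n)..1})"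
    unfolding U2 by (subst emeasure_density) (auto intro!: nn_integral_cong split: split_indicator)
  also have "\<dots> = (SUP n. emeasure (density lborel ?f) {psi c b (?a n)..1})"
    by (rule SUP_emeasure_incseq[symmetric]) (use incr a dec in \<open>auto simp: incseq_def intro: order_trans less_imp_le\<close>)
  also have "\<dots> = (SUP n. emeasure (density lborel (\<lambda>t. ?f (psi c b t) * ennreal (?d t))) {?a n..1})"
    by (simp only: eq)
  also have "\<dots> = emeasure (density lborel (\<lambda>t. ?f (psi c b t) * ennreal (?d t))) (\<Union>n. {?a n..1})"
    by (rule SUP_emeasure_incseq) (use dec in \<open>auto simp: incseq_def intro: order_trans\<close>)
  also have "\<dots> = (\<integral>\<^sup>+ t. ?f (psi c b t) * ennreal (?d t) * indicator {0<..1} t \<partial>lborel)"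
    unfolding U1 by (subst emeasure_density) auto
  also have "\<dots> = (\<integral>\<^sup>+ t. indicator {0<..<1} t * ennreal (1 / t) * (F (psi c b t) * ennreal (c - b / (1 - ln t))) \<partial>lborel)"
  proof (rule nn_integral_cong_AE, use AE_lborel_singleton[of "1::real"] in eventually_elim)
    case (elim t)
    show ?case
    proof (cases "0 < t \<and> t < 1")
      case True
      have pos: "0 < psi c b t" using True by (intro psi_pos) auto
      have "psi c b t \<le> t powr c" using True b by (intro psi_le_powr) auto
      also have "\<dots> < 1 powr c" using True c by (intro powr_less_mono2) auto
      finally have lt: "psi c b t < 1" by simp
      have m: "0 \<le> c - b / (1 - ln t)"
        using L[of t] b c True by (auto simp: divide_nonpos_pos order_trans[of _ 0])
      have "ennreal (1 / psi c b t) * ennreal (?d t) = ennreal (1 / psi c b t * ?d t)"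
        using pos d[of t] True by (intro ennreal_mult[symmetric]) auto
      also have "1 / psi c b t * ?d t = 1 / t * (c - b / (1 - ln t))"
        using pos True by simp
      also have "ennreal \<dots> = ennreal (1 / t) * ennreal (c - b / (1 - ln t))"
        using m True by (intro ennreal_mult) auto
      finally have "F (psi c b t) * (ennreal (1 / psi c b t) * ennreal (?d t)) = F (psi c b t) * (ennreal (1 / t) * ennreal (c - b / (1 - ln t)))"
        by simp
      then show ?thesis using True pos lt by (simp add: mult_ac)
    qed (use elim in auto)
  qed
  also have "\<dots> = (\<integral>\<^sup>+ t. F (psi c b t) * ennreal (c - b / (1 - ln t)) \<partial>dlog)"
    by (rule nn_integral_dlog[symmetric]) measurable
  finally show ?thesis .
qed

section \<open>The Lorentz-Zygmund and interpolation norms as integrals against ds/s\<close>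

lemma mono_K_func: "mono (K_func \<Omega> N0 N1 g)"
  unfolding K_func_def
  by (intro monoI INF_superset_mono) (auto intro!: add_mono mult_right_mono ennreal_leI)

lemma LZ_norm_eq_dlog:
  assumes "decr_rearr \<Omega> f \<in> borel_measurable borel" "\<And>s. 0 < s \<Longrightarrow> 0 \<le> decr_rearr \<Omega> f s"
  shows "LZ_norm \<Omega> a r \<beta> f = enn_powr (\<integral>\<^sup>+ t. enn_powr (ennreal (psi (1 / a) \<beta> t * decr_rearr \<Omega> f t)) r \<partial>dlog) (1 / r)"
proof -
  note assms(1) [measurable]
  have "(\<integral>\<^sup>+ t. indicator {0<..<1} t * ennreal ((t powr (1 / a) * (1 - ln t) powr \<beta> * decr_rearr \<Omega> f t) powr r / t) \<partial>lborel)
    = (\<integral>\<^sup>+ t. indicator {0<..<1} t * ennreal (1 / t) * enn_powr (ennreal (psi (1 / a) \<beta> t * decr_rearr \<Omega> f t)) r \<partial>lborel)"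
    by (intro nn_integral_cong)
       (auto split: split_indicator simp: assms(2) psi_def[symmetric] simp flip: ennreal_mult)
  also have "\<dots> = (\<integral>\<^sup>+ t. enn_powr (ennreal (psi (1 / a) \<beta> t * decr_rearr \<Omega> f t)) r \<partial>dlog)"
    by (rule nn_integral_dlog[symmetric]) measurable
  finally show ?thesis by (simp add: LZ_norm_def)
qed

lemma interp_norm_eq_dlog:
  "interp_norm \<Omega> N0 N1 \<theta> r g = enn_powr (\<integral>\<^sup>+ t. enn_powr (ennreal (t powr - \<theta>) * K_func \<Omega> N0 N1 g t) r \<partial>dlog) (1 / r)"
proof -
  have [measurable]: "K_func \<Omega> N0 N1 g \<in> borel_measurable borel"
    by (intro borel_measurable_mono_ennreal mono_K_func)
  show ?thesis
    unfolding interp_norm_def by (subst nn_integral_dlog) (auto simp: mult_ac)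
qed

section \<open>Interpolation of sandwiched couples\<close>

text \<open>The parameters \<open>c0\<close>, \<open>c1\<close>, \<open>c\<close> play the roles of \<open>1/p\<close>, \<open>1/q\<close>, \<open>1/a\<close>. The weight \<open>\<rho>\<close> is the
  quotient of the fundamental functions of the two spaces.\<close>

locale sandwiched_couple =
  fixes \<Omega> :: "'n::euclidean_space set" and N0 N1 :: "('n \<Rightarrow> real) \<Rightarrow> ennreal"
    and c0 c1 \<kappa> \<alpha> \<theta> c :: real
  assumes \<Omega>: "\<Omega> \<in> lmeasurable"
    and N0: "lorentz_sandwich \<Omega> c0 (\<kappa> - \<alpha> * c0) N0"
    and N1: "lorentz_sandwich \<Omega> c1 (\<kappa> - \<alpha> * c1) N1"
    and c1: "0 < c1" and c10: "c1 < c0" and \<alpha>: "0 < \<alpha>" and \<theta>: "0 < \<theta>" "\<theta> < 1"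
    and c: "c = (1 - \<theta>) * c0 + \<theta> * c1"
begin

section \<open>Weights of the couple and their kernel estimates\<close>

definition \<rho> :: "real \<Rightarrow> real" where
  "\<rho> = psi (c0 - c1) (- (\<alpha> * (c0 - c1)))"

abbreviation \<phi>0 :: "real \<Rightarrow> real" where "\<phi>0 \<equiv> psi c0 (\<kappa> - \<alpha> * c0)"
abbreviation \<phi>1 :: "real \<Rightarrow> real" where "\<phi>1 \<equiv> psi c1 (\<kappa> - \<alpha> * c1)"
abbreviation \<phi> :: "real \<Rightarrow> real" where "\<phi> \<equiv> psi c (\<kappa> - \<alpha> * c)"

lemma \<rho>_pos: "0 < t \<Longrightarrow> t \<le> 1 \<Longrightarrow> 0 < \<rho> t"
  by (simp add: \<rho>_def psi_pos)

text \<open>All logarithmic exponents are the same affine function of the power exponent, up to the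
  constant \<kappa>, which cancels in quotients. Interpolating the power exponents therefore
  interpolates the whole weights, as this and the next two identities record.\<close>

lemma \<phi>0_eq: "\<phi>0 t = \<rho> t * \<phi>1 t"
  by (simp add: \<rho>_def psi_mult algebra_simps)

lemma \<phi>0_eq': "\<phi>0 t = \<rho> t powr \<theta> * \<phi> t"
  by (simp add: \<rho>_def psi_mult psi_powr c algebra_simps)

lemma \<phi>_eq: "\<phi> t = \<rho> t powr (1 - \<theta>) * \<phi>1 t"
  by (simp add: \<rho>_def psi_mult psi_powr c algebra_simps)

lemma c_pos: "0 < c"
  unfolding c using c1 c10 \<theta> by (intro add_pos_pos mult_pos_pos) auto

lemma \<rho>_powr_le:
  assumes "0 < s" "s \<le> t" "t \<le> 1" "0 \<le> e"
  shows "\<rho> s powr e \<le> (s / t) powr ((c0 - c1) * e) * \<rho> t powr e"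
  unfolding \<rho>_def psi_powr using assms c10 \<alpha>
  by (intro psi_le_nonpos) (auto simp: mult_nonpos_nonneg)

text \<open>The minimum lets one kernel dominate both halves: the part s <= t decays with exponent
  \<theta>, the part s > t with exponent 1 - \<theta>.\<close>

definition \<delta> :: real where "\<delta> = (c0 - c1) * min \<theta> (1 - \<theta>)"

lemma \<delta>_pos: "0 < \<delta>"
  using c10 \<theta> by (simp add: \<delta>_def)

text \<open>The left side equals (\<rho>(s)/\<rho>(t))^\<theta> times \<phi>(s), and \<rho> grows at
  least like the power c0 - c1.\<close>

lemma \<phi>0_le_kernel:
  assumes "0 < s" "s \<le> t" "t \<le> 1"
  shows "\<rho> t powr - \<theta> * \<phi>0 s \<le> hkernel \<delta> s t * \<phi> s"
proof -
  have "(s / t) powr ((c0 - c1) * \<theta>) \<le> (s / t) powr \<delta>"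
    using assms c10 by (intro powr_mono') (auto simp: \<delta>_def)
  then have "\<rho> s powr \<theta> \<le> (s / t) powr \<delta> * \<rho> t powr \<theta>"
    using \<theta> assms by (intro order_trans[OF \<rho>_powr_le mult_right_mono]) auto
  then have "\<rho> t powr - \<theta> * (\<rho> s powr \<theta> * \<phi> s) \<le> \<rho> t powr - \<theta> * ((s / t) powr \<delta> * \<rho> t powr \<theta> * \<phi> s)"
    by (intro mult_left_mono mult_right_mono) auto
  also have "\<dots> = (s / t) powr \<delta> * \<phi> s"
    using \<rho>_pos[of t] assms by (simp add: powr_minus)
  finally show ?thesis using assms by (simp add: \<phi>0_eq' hkernel_def)
qed

text \<open>The mirror case: here the left side equals (\<rho>(t)/\<rho>(s))^(1 - \<theta>) times
  \<phi>(s).\<close>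

lemma \<phi>1_le_kernel:
  assumes "0 < t" "t < s" "s \<le> 1"
  shows "\<rho> t powr (1 - \<theta>) * \<phi>1 s \<le> hkernel \<delta> s t * \<phi> s"
proof -
  have "(t / s) powr ((c0 - c1) * (1 - \<theta>)) \<le> (t / s) powr \<delta>"
    using assms c10 by (intro powr_mono') (auto simp: \<delta>_def)
  then have "\<rho> t powr (1 - \<theta>) \<le> (t / s) powr \<delta> * \<rho> s powr (1 - \<theta>)"
    using \<theta> assms by (intro order_trans[OF \<rho>_powr_le mult_right_mono]) auto
  then have "\<rho> t powr (1 - \<theta>) * \<phi>1 s \<le> (t / s) powr \<delta> * \<rho> s powr (1 - \<theta>) * \<phi>1 s"
    by (intro mult_right_mono) auto
  then show ?thesis using assms by (simp add: \<phi>_eq[of s] hkernel_def mult.assoc)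
qed

text \<open>For any decomposition, f*(t) is at most the sum of the two rearrangements at t/2.
  Multiplied by \<open>\<phi>0 t = \<rho> t * \<phi>1 t\<close>, the summands fall under the lower
  endpoint bounds for N0 and N1, with exactly the factor \<rho>(t) of the K-functional in front of
  the second.\<close>

lemma K_func_lower:
  obtains A where "0 < A" "\<And>f t. f \<in> borel_measurable (lebesgue_on \<Omega>) \<Longrightarrow> 0 < t \<Longrightarrow> t < 1 \<Longrightarrow>
     ennreal (\<phi> t * decr_rearr \<Omega> f t) \<le> ennreal A * (ennreal (\<rho> t powr - \<theta>) * K_func \<Omega> N0 N1 f (\<rho> t))"
proof -
  obtain A0 where A0: "0 < A0" "\<And>f t. f \<in> borel_measurable (lebesgue_on \<Omega>) \<Longrightarrow> 0 < t \<Longrightarrow> t < 1 \<Longrightarrow>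
      ennreal (\<phi>0 t * decr_rearr \<Omega> f (t / 2)) \<le> ennreal A0 * N0 f"
    using N0 unfolding lorentz_sandwich_def by blast
  obtain A1 where A1: "0 < A1" "\<And>f t. f \<in> borel_measurable (lebesgue_on \<Omega>) \<Longrightarrow> 0 < t \<Longrightarrow> t < 1 \<Longrightarrow>
      ennreal (\<phi>1 t * decr_rearr \<Omega> f (t / 2)) \<le> ennreal A1 * N1 f"
    using N1 unfolding lorentz_sandwich_def by blast
  define A where "A = max A0 A1"
  have A: "0 < A" "A0 \<le> A" "A1 \<le> A" using A0 by (auto simp: A_def)
  show ?thesis
  proof (rule that[OF A(1)])
    fix f :: "'n \<Rightarrow> real" and t :: real
    assume f: "f \<in> borel_measurable (lebesgue_on \<Omega>)" and t: "0 < t" "t < 1"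
    have ft: "0 \<le> decr_rearr \<Omega> f t" by (rule decr_rearr_nonneg[OF \<Omega> f t(1)])
    have \<rho>t: "0 < \<rho> t" using t by (intro \<rho>_pos) auto
    have "ennreal (\<phi>0 t * decr_rearr \<Omega> f t / A) \<le> K_func \<Omega> N0 N1 f (\<rho> t)"
      unfolding K_func_def
    proof (rule INF_greatest, clarify)
      fix g0 g1 :: "'n \<Rightarrow> real"
      assume g: "g0 \<in> borel_measurable (lebesgue_on \<Omega>)" "g1 \<in> borel_measurable (lebesgue_on \<Omega>)"
        and sum: "\<forall>x\<in>\<Omega>. f x = g0 x + g1 x"
      have g_nonneg: "0 \<le> decr_rearr \<Omega> g0 (t / 2)" "0 \<le> decr_rearr \<Omega> g1 (t / 2)"
        using t by (auto intro: decr_rearr_nonneg[OF \<Omega>] g)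
      have "decr_rearr \<Omega> f (t / 2 + t / 2) \<le> decr_rearr \<Omega> g0 (t / 2) + decr_rearr \<Omega> g1 (t / 2)"
        using t sum by (intro decr_rearr_add[OF \<Omega>] g) auto
      then have "\<phi>0 t * decr_rearr \<Omega> f t \<le> \<phi>0 t * (decr_rearr \<Omega> g0 (t / 2) + decr_rearr \<Omega> g1 (t / 2))"
        by (intro mult_left_mono) auto
      also have "\<dots> = \<phi>0 t * decr_rearr \<Omega> g0 (t / 2) + \<rho> t * (\<phi>1 t * decr_rearr \<Omega> g1 (t / 2))"
        by (simp add: distrib_left) (simp add: \<phi>0_eq)
      finally have "ennreal (\<phi>0 t * decr_rearr \<Omega> f t)
         \<le> ennreal (\<phi>0 t * decr_rearr \<Omega> g0 (t / 2)) + ennreal (\<rho> t) * ennreal (\<phi>1 t * decr_rearr \<Omega> g1 (t / 2))"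
        using g_nonneg \<rho>t by (simp flip: ennreal_mult ennreal_plus add: ennreal_leI)
      also have "\<dots> \<le> ennreal A0 * N0 g0 + ennreal (\<rho> t) * (ennreal A1 * N1 g1)"
        by (intro add_mono mult_left_mono A0 A1 g t) auto
      also have "\<dots> \<le> ennreal A * N0 g0 + ennreal (\<rho> t) * (ennreal A * N1 g1)"
        using A by (intro add_mono mult_left_mono mult_right_mono ennreal_leI) auto
      also have "\<dots> = ennreal A * (N0 g0 + ennreal (\<rho> t) * N1 g1)"
        by (simp add: distrib_left mult_ac)
      finally have "ennreal (1 / A) * ennreal (\<phi>0 t * decr_rearr \<Omega> f t)
          \<le> ennreal (1 / A) * (ennreal A * (N0 g0 + ennreal (\<rho> t) * N1 g1))"
        by (intro mult_left_mono) auto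
      also have "\<dots> = N0 g0 + ennreal (\<rho> t) * N1 g1"
        using A by (simp flip: mult.assoc ennreal_mult)
      finally show "ennreal (\<phi>0 t * decr_rearr \<Omega> f t / A) \<le> N0 (fst (g0, g1)) + ennreal (\<rho> t) * N1 (snd (g0, g1))"
        using A ft by (simp flip: ennreal_mult)
    qed
    then have "ennreal A * (ennreal (\<rho> t powr - \<theta>) * ennreal (\<phi>0 t * decr_rearr \<Omega> f t / A))
       \<le> ennreal A * (ennreal (\<rho> t powr - \<theta>) * K_func \<Omega> N0 N1 f (\<rho> t))"
      by (intro mult_left_mono) auto
    moreover have "ennreal A * (ennreal (\<rho> t powr - \<theta>) * ennreal (\<phi>0 t * decr_rearr \<Omega> f t / A)) = ennreal (\<phi> t * decr_rearr \<Omega> f t)"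
      using A ft \<rho>t by (simp flip: ennreal_mult add: \<phi>0_eq' powr_minus)
    ultimately show "ennreal (\<phi> t * decr_rearr \<Omega> f t) \<le> ennreal A * (ennreal (\<rho> t powr - \<theta>) * K_func \<Omega> N0 N1 f (\<rho> t))"
      by simp
  qed
qed

text \<open>Cut f at height f*(t). The rearrangement of the upper part f0 vanishes from t on, that
  of the lower part f1 is at most both f*(t) and f*(s). The pieces s <= t of f0 and s > t of f1 fit
  the kernel directly; the flat piece of f1 on (0, t] is reduced to \<phi>(t) f*(t).\<close>

lemma K_func_upper:
  obtains B where "0 < B" "\<And>f t. f \<in> borel_measurable (lebesgue_on \<Omega>) \<Longrightarrow> 0 < t \<Longrightarrow> t < 1 \<Longrightarrow>
     ennreal (\<rho> t powr - \<theta>) * K_func \<Omega> N0 N1 f (\<rho> t)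
       \<le> ennreal B * (\<integral>\<^sup>+ s. ennreal (hkernel \<delta> s t) * ennreal (\<phi> s * decr_rearr \<Omega> f s) \<partial>dlog)"
proof -
  obtain A0 where A0: "0 < A0" "\<And>f. f \<in> borel_measurable (lebesgue_on \<Omega>) \<Longrightarrow>
      N0 f \<le> ennreal A0 * (\<integral>\<^sup>+ s. ennreal (\<phi>0 s * decr_rearr \<Omega> f s) \<partial>dlog)"
    using N0 unfolding lorentz_sandwich_def by blast
  obtain A1 where A1: "0 < A1" "\<And>f. f \<in> borel_measurable (lebesgue_on \<Omega>) \<Longrightarrow>
      N1 f \<le> ennreal A1 * (\<integral>\<^sup>+ s. ennreal (\<phi>1 s * decr_rearr \<Omega> f s) \<partial>dlog)"
    using N1 unfolding lorentz_sandwich_def by blast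
  obtain C where C: "0 < C"
    "\<And>s t. 0 < s \<Longrightarrow> s \<le> t \<Longrightarrow> t \<le> 1 \<Longrightarrow> \<phi>1 s \<le> C * (s / t) powr (c1 / 2) * \<phi>1 t"
    using psi_growth[OF c1, of "\<kappa> - \<alpha> * c1"] by blast
  define Q where "Q = 2 * 2 powr (c + \<delta> + \<bar>\<kappa> - \<alpha> * c\<bar>)"
  have Q: "0 < Q" by (simp add: Q_def)
  define B where "B = A0 + A1 * (2 * C / c1 * Q + 1)"
  have B: "0 < B"
    unfolding B_def using A0 A1 C Q c1 by (intro add_pos_nonneg) auto
  show ?thesis
  proof (rule that[OF B])
    fix f :: "'n \<Rightarrow> real" and t :: real
    assume f: "f \<in> borel_measurable (lebesgue_on \<Omega>)" and t: "0 < t" "t < 1"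
    define g where "g = decr_rearr \<Omega> f"
    have [measurable]: "g \<in> borel_measurable borel"
      unfolding g_def by (rule decr_rearr_measurable[OF \<Omega> f])
    have g0: "0 \<le> g s" if "0 < s" for s
      unfolding g_def by (rule decr_rearr_nonneg[OF \<Omega> f that])
    have \<rho>t: "0 < \<rho> t" using t by (intro \<rho>_pos) auto
    define J where "J = (\<integral>\<^sup>+ s. ennreal (hkernel \<delta> s t) * ennreal (\<phi> s * g s) \<partial>dlog)"
    define f0 f1 where "f0 = (\<lambda>x. if g t < \<bar>f x\<bar> then f x else 0)"
      and "f1 = (\<lambda>x. if g t < \<bar>f x\<bar> then 0 else f x)"
    note f [measurable]
    have f0: "f0 \<in> borel_measurable (lebesgue_on \<Omega>)" and f1: "f1 \<in> borel_measurable (lebesgue_on \<Omega>)"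
      unfolding f0_def f1_def by measurable
    have f0_le: "decr_rearr \<Omega> f0 s \<le> g s" if "0 < s" for s
      unfolding g_def by (rule decr_rearr_mono[OF \<Omega> f that]) (auto simp: f0_def)
    have f0_zero: "decr_rearr \<Omega> f0 s \<le> 0" if "t \<le> s" for s
      unfolding f0_def g_def by (rule decr_rearr_above[OF \<Omega> f t(1) that])
    have f1_le: "decr_rearr \<Omega> f1 s \<le> g s" if "0 < s" for s
      unfolding g_def by (rule decr_rearr_mono[OF \<Omega> f that]) (auto simp: f1_def)
    have f1_le': "decr_rearr \<Omega> f1 s \<le> g t" if "0 < s" for s
      unfolding f1_def g_def by (rule decr_rearr_below[OF \<Omega> f t(1) that])
    have m1: "(\<lambda>s. ennreal (\<phi>1 s * decr_rearr \<Omega> f1 s)) \<in> borel_measurable borel"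
      and m0: "(\<lambda>s. ennreal (\<phi>0 s * decr_rearr \<Omega> f0 s)) \<in> borel_measurable borel"
      using decr_rearr_measurable[OF \<Omega> f0] decr_rearr_measurable[OF \<Omega> f1] by measurable

    have I0: "ennreal (\<rho> t powr - \<theta>) * (\<integral>\<^sup>+ s. ennreal (\<phi>0 s * decr_rearr \<Omega> f0 s) \<partial>dlog) \<le> J"
    proof -
      have "ennreal (\<rho> t powr - \<theta>) * (\<integral>\<^sup>+ s. ennreal (\<phi>0 s * decr_rearr \<Omega> f0 s) \<partial>dlog)
         = (\<integral>\<^sup>+ s. ennreal (\<rho> t powr - \<theta>) * ennreal (\<phi>0 s * decr_rearr \<Omega> f0 s) \<partial>dlog)"
        using m0 by (intro nn_integral_cmult[symmetric]) simp
      also have "\<dots> \<le> J"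
        unfolding J_def
      proof (rule nn_integral_dlog_mono)
        fix s :: real assume s: "0 < s" "s < 1"
        have "\<rho> t powr - \<theta> * (\<phi>0 s * decr_rearr \<Omega> f0 s) \<le> hkernel \<delta> s t * (\<phi> s * g s)"
        proof (cases "s \<le> t")
          case True
          have "\<rho> t powr - \<theta> * (\<phi>0 s * decr_rearr \<Omega> f0 s) \<le> \<rho> t powr - \<theta> * (\<phi>0 s * g s)"
            by (intro mult_left_mono f0_le s) auto
          also have "\<dots> \<le> hkernel \<delta> s t * \<phi> s * g s"
            unfolding mult.assoc[symmetric] using True s t by (intro mult_right_mono \<phi>0_le_kernel g0) auto
          finally show ?thesis by (simp add: mult.assoc)
        next
          case False
          then have "\<rho> t powr - \<theta> * (\<phi>0 s * decr_rearr \<Omega> f0 s) \<le> 0"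
            using f0_zero[of s] by (intro mult_nonneg_nonpos) auto
          also have "0 \<le> hkernel \<delta> s t * (\<phi> s * g s)"
            using g0[OF s(1)] by (intro mult_nonneg_nonneg) auto
          finally show ?thesis .
        qed
        then show "ennreal (\<rho> t powr - \<theta>) * ennreal (\<phi>0 s * decr_rearr \<Omega> f0 s)
            \<le> ennreal (hkernel \<delta> s t) * ennreal (\<phi> s * g s)"
          using g0[OF s(1)] by (simp flip: ennreal_mult' ennreal_mult'' add: ennreal_leI)
      qed
      finally show ?thesis .
    qed

    \<comment> \<open>For s <= t the kernel is (s/t)^\<delta>, so it can be merged with \<phi> into
      one weight of power exponent c + \<delta>. Applying \<open>quasi_monotone\<close> to that
      weight explains the constant Q.\<close>
    have head: "ennreal (\<phi> t * g t) \<le> ennreal Q * J"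
    proof -
      have "ennreal (t powr \<delta>) * ennreal (\<phi> t * g t) = ennreal (psi (c + \<delta>) (\<kappa> - \<alpha> * c) t * g t)"
        using g0[OF t(1)] by (simp flip: ennreal_mult add: psi_def powr_add mult_ac)
      also have "\<dots> \<le> ennreal Q * (\<integral>\<^sup>+ s. indicator {0<..t} s * ennreal (psi (c + \<delta>) (\<kappa> - \<alpha> * c) s * g s) \<partial>dlog)"
        unfolding Q_def
        using t c_pos \<delta>_pos g0 decr_rearr_antimono[OF \<Omega> f]
        by (intro quasi_monotone) (auto simp: g_def monotone_on_def)
      also have "(\<integral>\<^sup>+ s. indicator {0<..t} s * ennreal (psi (c + \<delta>) (\<kappa> - \<alpha> * c) s * g s) \<partial>dlog)
          \<le> (\<integral>\<^sup>+ s. ennreal (t powr \<delta>) * (ennreal (hkernel \<delta> s t) * ennreal (\<phi> s * g s)) \<partial>dlog)"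
      proof (rule nn_integral_dlog_mono)
        fix s :: real assume s: "0 < s" "s < 1"
        have "psi (c + \<delta>) (\<kappa> - \<alpha> * c) s * g s = t powr \<delta> * (hkernel \<delta> s t * (\<phi> s * g s))" if "s \<le> t"
          using s t that by (simp add: hkernel_def psi_def powr_add powr_divide)
        then show "indicator {0<..t} s * ennreal (psi (c + \<delta>) (\<kappa> - \<alpha> * c) s * g s)
          \<le> ennreal (t powr \<delta>) * (ennreal (hkernel \<delta> s t) * ennreal (\<phi> s * g s))"
          using g0[OF s(1)] by (auto split: split_indicator simp flip: ennreal_mult)
      qed
      also have "\<dots> = ennreal (t powr \<delta>) * J"
        unfolding J_def by (rule nn_integral_cmult) measurable
      finally have "ennreal (t powr - \<delta>) * (ennreal (t powr \<delta>) * ennreal (\<phi> t * g t))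
         \<le> ennreal (t powr - \<delta>) * (ennreal Q * (ennreal (t powr \<delta>) * J))"
        by (simp add: mult_left_mono)
      moreover have "ennreal (t powr - \<delta>) * ennreal (t powr \<delta>) = 1"
        using t by (simp flip: ennreal_mult powr_add)
      ultimately show ?thesis
        by (metis mult.assoc mult.left_commute mult_1)
    qed

    have I1: "ennreal (\<rho> t powr (1 - \<theta>)) * (\<integral>\<^sup>+ s. ennreal (\<phi>1 s * decr_rearr \<Omega> f1 s) \<partial>dlog)
        \<le> ennreal (2 * C / c1 * Q + 1) * J"
    proof -
      \<comment> \<open>Collects everything independent of s on (0, t], where f1* is bounded by g(t)
        and \<open>psi_growth\<close> compares \<phi>1(s) with \<phi>1(t). The remaining integral of
        s^(c1/2) produces the factor 2/c1.\<close>
      let ?k = "t powr - (c1 / 2) * (C * (\<phi> t * g t))"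
      have k: "0 \<le> ?k" using C g0[OF t(1)] by simp
      have "ennreal (\<rho> t powr (1 - \<theta>)) * (\<integral>\<^sup>+ s. ennreal (\<phi>1 s * decr_rearr \<Omega> f1 s) \<partial>dlog)
         = (\<integral>\<^sup>+ s. ennreal (\<rho> t powr (1 - \<theta>)) * ennreal (\<phi>1 s * decr_rearr \<Omega> f1 s) \<partial>dlog)"
        using m1 by (intro nn_integral_cmult[symmetric]) simp
      also have "\<dots> \<le> (\<integral>\<^sup>+ s. ennreal ?k * (indicator {0<..t} s * ennreal (s powr (c1 / 2)))
            + ennreal (hkernel \<delta> s t) * ennreal (\<phi> s * g s) \<partial>dlog)"
      proof (rule nn_integral_dlog_mono)
        fix s :: real assume s: "0 < s" "s < 1"
        show "ennreal (\<rho> t powr (1 - \<theta>)) * ennreal (\<phi>1 s * decr_rearr \<Omega> f1 s)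
          \<le> ennreal ?k * (indicator {0<..t} s * ennreal (s powr (c1 / 2))) + ennreal (hkernel \<delta> s t) * ennreal (\<phi> s * g s)"
        proof (cases "s \<le> t")
          case True
          have "\<rho> t powr (1 - \<theta>) * (\<phi>1 s * decr_rearr \<Omega> f1 s)
              \<le> \<rho> t powr (1 - \<theta>) * (C * (s / t) powr (c1 / 2) * \<phi>1 t * g t)"
            using True s t g0 by (intro mult_left_mono order_trans[OF mult_left_mono[OF f1_le'] mult_right_mono] C(2)) auto
          also have "\<dots> = ?k * s powr (c1 / 2)"
            using s t by (simp add: \<phi>_eq[of t] powr_divide powr_minus field_simps)
          finally have "ennreal (\<rho> t powr (1 - \<theta>)) * ennreal (\<phi>1 s * decr_rearr \<Omega> f1 s)
              \<le> ennreal ?k * ennreal (s powr (c1 / 2))"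
            using k by (simp flip: ennreal_mult' ennreal_mult'' add: ennreal_leI)
          then show ?thesis using True s by (simp add: add_increasing2)
        next
          case False
          have "\<rho> t powr (1 - \<theta>) * (\<phi>1 s * decr_rearr \<Omega> f1 s) \<le> \<rho> t powr (1 - \<theta>) * (\<phi>1 s * g s)"
            by (intro mult_left_mono f1_le s) auto
          also have "\<dots> \<le> hkernel \<delta> s t * \<phi> s * g s"
            unfolding mult.assoc[symmetric] using False s t by (intro mult_right_mono \<phi>1_le_kernel g0) auto
          finally have "ennreal (\<rho> t powr (1 - \<theta>)) * ennreal (\<phi>1 s * decr_rearr \<Omega> f1 s)
              \<le> ennreal (hkernel \<delta> s t) * ennreal (\<phi> s * g s)"
            using g0[OF s(1)] by (simp flip: ennreal_mult' ennreal_mult'' add: ennreal_leI mult.assoc)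
          then show ?thesis using False by simp
        qed
      qed
      also have "\<dots> = ennreal ?k * (\<integral>\<^sup>+ s. indicator {0<..t} s * ennreal (s powr (c1 / 2)) \<partial>dlog) + J"
        unfolding J_def by (simp add: nn_integral_add nn_integral_cmult)
      also have "\<dots> \<le> ennreal ?k * ennreal (t powr (c1 / 2) / (c1 / 2)) + J"
        using t c1 by (intro add_right_mono mult_left_mono nn_integral_dlog_powr_le) auto
      also have "ennreal ?k * ennreal (t powr (c1 / 2) / (c1 / 2)) = ennreal (2 * C / c1) * ennreal (\<phi> t * g t)"
      proof -
        have "?k * (t powr (c1 / 2) / (c1 / 2)) = 2 * C / c1 * (\<phi> t * g t)"
          using t c1 by (simp add: powr_minus field_simps)
        then show ?thesis
          using k c1 C g0[OF t(1)] by (simp only: ennreal_mult[symmetric] mult_nonneg_nonneg divide_nonneg_pos psi_nonneg powr_ge_zero)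
      qed
      also have "\<dots> + J \<le> ennreal (2 * C / c1) * (ennreal Q * J) + J"
        by (intro add_right_mono mult_left_mono head) auto
      also have "\<dots> = ennreal (2 * C / c1 * Q + 1) * J"
      proof -
        have "ennreal (2 * C / c1 * Q + 1) = ennreal (2 * C / c1 * Q) + ennreal 1"
          using C c1 Q by (intro ennreal_plus) auto
        moreover have "ennreal (2 * C / c1 * Q) = ennreal (2 * C / c1) * ennreal Q"
          using C c1 Q by (intro ennreal_mult) auto
        ultimately show ?thesis
          by (simp only: distrib_right mult.assoc ennreal_1 mult_1)
      qed
      finally show ?thesis .
    qed

    have "K_func \<Omega> N0 N1 f (\<rho> t) \<le> N0 (fst (f0, f1)) + ennreal (\<rho> t) * N1 (snd (f0, f1))"
      unfolding K_func_def by (rule INF_lower) (auto simp: f0 f1, auto simp: f0_def f1_def)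
    also have "\<dots> \<le> ennreal A0 * (\<integral>\<^sup>+ s. ennreal (\<phi>0 s * decr_rearr \<Omega> f0 s) \<partial>dlog)
        + ennreal (\<rho> t) * (ennreal A1 * (\<integral>\<^sup>+ s. ennreal (\<phi>1 s * decr_rearr \<Omega> f1 s) \<partial>dlog))"
      using A0(2)[OF f0] A1(2)[OF f1] by (auto intro!: add_mono mult_left_mono)
    finally have "ennreal (\<rho> t powr - \<theta>) * K_func \<Omega> N0 N1 f (\<rho> t)
      \<le> ennreal (\<rho> t powr - \<theta>) * (ennreal A0 * (\<integral>\<^sup>+ s. ennreal (\<phi>0 s * decr_rearr \<Omega> f0 s) \<partial>dlog)
        + ennreal (\<rho> t) * (ennreal A1 * (\<integral>\<^sup>+ s. ennreal (\<phi>1 s * decr_rearr \<Omega> f1 s) \<partial>dlog)))"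
      by (intro mult_left_mono) auto
    also have "\<dots> = ennreal A0 * (ennreal (\<rho> t powr - \<theta>) * (\<integral>\<^sup>+ s. ennreal (\<phi>0 s * decr_rearr \<Omega> f0 s) \<partial>dlog))
        + ennreal A1 * (ennreal (\<rho> t powr - \<theta>) * ennreal (\<rho> t) * (\<integral>\<^sup>+ s. ennreal (\<phi>1 s * decr_rearr \<Omega> f1 s) \<partial>dlog))"
      by (simp add: distrib_left mult_ac)
    also have "ennreal (\<rho> t powr - \<theta>) * ennreal (\<rho> t) = ennreal (\<rho> t powr (1 - \<theta>))"
      using \<rho>t by (simp flip: ennreal_mult add: powr_diff powr_minus field_simps)
    also have "ennreal A0 * (ennreal (\<rho> t powr - \<theta>) * (\<integral>\<^sup>+ s. ennreal (\<phi>0 s * decr_rearr \<Omega> f0 s) \<partial>dlog))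
        + ennreal A1 * (ennreal (\<rho> t powr (1 - \<theta>)) * (\<integral>\<^sup>+ s. ennreal (\<phi>1 s * decr_rearr \<Omega> f1 s) \<partial>dlog))
        \<le> ennreal A0 * J + ennreal A1 * (ennreal (2 * C / c1 * Q + 1) * J)"
      by (intro add_mono mult_left_mono I0 I1) auto
    also have "\<dots> = ennreal B * J"
      using A0 A1 C c1 Q by (simp add: B_def distrib_right ennreal_mult mult.assoc)
    finally show "ennreal (\<rho> t powr - \<theta>) * K_func \<Omega> N0 N1 f (\<rho> t)
       \<le> ennreal B * (\<integral>\<^sup>+ s. ennreal (hkernel \<delta> s t) * ennreal (\<phi> s * decr_rearr \<Omega> f s) \<partial>dlog)"
      by (simp add: J_def g_def)
  qed
qed

text \<open>Substitute u = \<rho>(t) in the interpolation norm. One inequality is then pointwise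
  from \<open>K_func_lower\<close>; the other follows from \<open>K_func_upper\<close> and
  boundedness of the kernel operator on L^r(ds/s).\<close>

lemma equiv_norms_LZ_interp:
  assumes r: "1 < r"
  shows "equiv_norms \<Omega> (LZ_norm \<Omega> (1 / c) r (\<kappa> - \<alpha> * c)) (interp_norm \<Omega> N0 N1 \<theta> r)"
proof -
  obtain A where A: "0 < A" "\<And>f t. f \<in> borel_measurable (lebesgue_on \<Omega>) \<Longrightarrow> 0 < t \<Longrightarrow> t < 1 \<Longrightarrow>
     ennreal (\<phi> t * decr_rearr \<Omega> f t) \<le> ennreal A * (ennreal (\<rho> t powr - \<theta>) * K_func \<Omega> N0 N1 f (\<rho> t))"
    using K_func_lower by blast
  obtain B where B: "0 < B" "\<And>f t. f \<in> borel_measurable (lebesgue_on \<Omega>) \<Longrightarrow> 0 < t \<Longrightarrow> t < 1 \<Longrightarrow>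
     ennreal (\<rho> t powr - \<theta>) * K_func \<Omega> N0 N1 f (\<rho> t)
       \<le> ennreal B * (\<integral>\<^sup>+ s. ennreal (hkernel \<delta> s t) * ennreal (\<phi> s * decr_rearr \<Omega> f s) \<partial>dlog)"
    using K_func_upper by blast
  define \<sigma> where "\<sigma> = c0 - c1"
  have \<sigma>: "0 < \<sigma>" using c10 by (simp add: \<sigma>_def)
  \<comment> \<open>The density of du/u with respect to dt/t. The double minus keeps the shape of
    the substitution lemma, whose logarithmic exponent is negative here. As 1 - ln t >= 1, this
    density lies between two positive constants.\<close>
  define m where "m = (\<lambda>t. \<sigma> - - (\<alpha> * \<sigma>) / (1 - ln t))"
  have m: "\<sigma> \<le> m t" "m t \<le> \<sigma> * (1 + \<alpha>)" if "0 < t" "t < 1" for t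
  proof -
    have L: "1 \<le> 1 - ln t" using that by simp
    then have "\<alpha> * \<sigma> / (1 - ln t) \<le> \<alpha> * \<sigma> / 1"
      using \<sigma> \<alpha> by (intro divide_left_mono) auto
    moreover have "0 \<le> \<alpha> * \<sigma> / (1 - ln t)" using L \<sigma> \<alpha> by simp
    ultimately show "\<sigma> \<le> m t" "m t \<le> \<sigma> * (1 + \<alpha>)" by (auto simp: m_def algebra_simps)
  qed
  \<comment> \<open>The product of the upper bound of m, the r-th power of the K-functional constant
    and the Hardy constant; V below uses the lower bound of m.\<close>
  define U where "U = \<sigma> * (1 + \<alpha>) * (B powr r * (2 / \<delta>) powr r)"
  have U: "0 < U" using \<sigma> \<alpha> B \<delta>_pos by (simp add: U_def)
  define V where "V = A powr r / \<sigma>"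
  have V: "0 < V" using \<sigma> A by (simp add: V_def)
  have main: "LZ_norm \<Omega> (1 / c) r (\<kappa> - \<alpha> * c) f \<le> ennreal (V powr (1 / r)) * interp_norm \<Omega> N0 N1 \<theta> r f"
    "interp_norm \<Omega> N0 N1 \<theta> r f \<le> ennreal (U powr (1 / r)) * LZ_norm \<Omega> (1 / c) r (\<kappa> - \<alpha> * c) f"
    if f: "f \<in> borel_measurable (lebesgue_on \<Omega>)" for f
  proof -
    define g where "g = decr_rearr \<Omega> f"
    have [measurable]: "g \<in> borel_measurable borel"
      unfolding g_def by (rule decr_rearr_measurable[OF \<Omega> f])
    have [measurable]: "K_func \<Omega> N0 N1 f \<in> borel_measurable borel"
      by (intro borel_measurable_mono_ennreal mono_K_func)
    have [measurable]: "\<rho> \<in> borel_measurable borel" "m \<in> borel_measurable borel"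
      unfolding \<rho>_def m_def by measurable
    define E where "E = (\<lambda>t. ennreal (\<rho> t powr - \<theta>) * K_func \<Omega> N0 N1 f (\<rho> t))"
    have [measurable]: "E \<in> borel_measurable borel" unfolding E_def by measurable
    define I where "I = (\<integral>\<^sup>+ t. enn_powr (E t) r * ennreal (m t) \<partial>dlog)"
    define P where "P = (\<integral>\<^sup>+ t. enn_powr (ennreal (\<phi> t * g t)) r \<partial>dlog)"
    have "(\<integral>\<^sup>+ t. enn_powr (ennreal (t powr - \<theta>) * K_func \<Omega> N0 N1 f t) r \<partial>dlog) = I"
      unfolding I_def E_def m_def \<rho>_def \<sigma>_def
      by (rule nn_integral_dlog_substitution) (use c10 \<alpha> in auto)
    then have interp: "interp_norm \<Omega> N0 N1 \<theta> r f = enn_powr I (1 / r)"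
      by (simp add: interp_norm_eq_dlog)
    have LZ: "LZ_norm \<Omega> (1 / c) r (\<kappa> - \<alpha> * c) f = enn_powr P (1 / r)"
      unfolding P_def g_def
      by (subst LZ_norm_eq_dlog) (auto intro: decr_rearr_measurable[OF \<Omega> f] decr_rearr_nonneg[OF \<Omega> f])
    have "P \<le> (\<integral>\<^sup>+ t. ennreal V * (enn_powr (E t) r * ennreal (m t)) \<partial>dlog)"
      unfolding P_def
    proof (rule nn_integral_dlog_mono)
      fix t :: real assume t: "0 < t" "t < 1"
      have "enn_powr (ennreal (\<phi> t * g t)) r \<le> enn_powr (ennreal A * E t) r"
        unfolding g_def E_def using r by (intro enn_powr_mono A f t) auto
      also have "\<dots> = ennreal V * (enn_powr (E t) r * ennreal \<sigma>)"
      proof -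
        have "ennreal (A powr r) = ennreal V * ennreal \<sigma>"
          using V \<sigma> by (simp add: V_def flip: ennreal_mult)
        then show ?thesis using A by (simp add: enn_powr_mult mult_ac)
      qed
      also have "\<dots> \<le> ennreal V * (enn_powr (E t) r * ennreal (m t))"
        by (intro mult_left_mono ennreal_leI m t) auto
      finally show "enn_powr (ennreal (\<phi> t * g t)) r \<le> ennreal V * (enn_powr (E t) r * ennreal (m t))" .
    qed
    also have "\<dots> = ennreal V * I"
      unfolding I_def by (rule nn_integral_cmult) measurable
    finally have "enn_powr P (1 / r) \<le> enn_powr (ennreal V * I) (1 / r)"
      using r by (intro enn_powr_mono) auto
    then show "LZ_norm \<Omega> (1 / c) r (\<kappa> - \<alpha> * c) f \<le> ennreal (V powr (1 / r)) * interp_norm \<Omega> N0 N1 \<theta> r f"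
      using V by (simp add: LZ interp enn_powr_mult)
    have "I \<le> (\<integral>\<^sup>+ t. ennreal (\<sigma> * (1 + \<alpha>) * B powr r) *
        enn_powr (\<integral>\<^sup>+ s. ennreal (hkernel \<delta> s t) * ennreal (\<phi> s * g s) \<partial>dlog) r \<partial>dlog)"
      unfolding I_def
    proof (rule nn_integral_dlog_mono)
      fix t :: real assume t: "0 < t" "t < 1"
      let ?J = "\<integral>\<^sup>+ s. ennreal (hkernel \<delta> s t) * ennreal (\<phi> s * g s) \<partial>dlog"
      have "enn_powr (E t) r * ennreal (m t) \<le> enn_powr (ennreal B * ?J) r * ennreal (\<sigma> * (1 + \<alpha>))"
        unfolding g_def E_def using r by (intro mult_mono enn_powr_mono ennreal_leI B m f t) auto
      also have "\<dots> = ennreal (\<sigma> * (1 + \<alpha>) * B powr r) * enn_powr ?J r"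
        using B \<sigma> \<alpha> by (simp add: enn_powr_mult ennreal_mult mult_ac)
      finally show "enn_powr (E t) r * ennreal (m t) \<le> ennreal (\<sigma> * (1 + \<alpha>) * B powr r) * enn_powr ?J r" .
    qed
    also have "\<dots> = ennreal (\<sigma> * (1 + \<alpha>) * B powr r) *
        (\<integral>\<^sup>+ t. enn_powr (\<integral>\<^sup>+ s. ennreal (hkernel \<delta> s t) * ennreal (\<phi> s * g s) \<partial>dlog) r \<partial>dlog)"
    proof (rule nn_integral_cmult)
      interpret sigma_finite_measure dlog by (rule sigma_finite_dlog)
      show "(\<lambda>t. enn_powr (\<integral>\<^sup>+ s. ennreal (hkernel \<delta> s t) * ennreal (\<phi> s * g s) \<partial>dlog) r) \<in> borel_measurable dlog"
        by measurable
    qed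
    also have "\<dots> \<le> ennreal (\<sigma> * (1 + \<alpha>) * B powr r) * (ennreal ((2 / \<delta>) powr r) * P)"
      unfolding P_def using r \<delta>_pos by (intro mult_left_mono hardy_inequality) auto
    also have "\<dots> = ennreal U * P"
      using \<sigma> \<alpha> by (simp add: U_def ennreal_mult mult.assoc)
    finally have "enn_powr I (1 / r) \<le> enn_powr (ennreal U * P) (1 / r)"
      using r by (intro enn_powr_mono) auto
    then show "interp_norm \<Omega> N0 N1 \<theta> r f \<le> ennreal (U powr (1 / r)) * LZ_norm \<Omega> (1 / c) r (\<kappa> - \<alpha> * c) f"
      using U by (simp add: LZ interp enn_powr_mult)
  qed
  show ?thesis
    unfolding equiv_norms_def
  proof (intro exI conjI ballI)
    fix f :: "'n \<Rightarrow> real" assume f: "f \<in> borel_measurable (lebesgue_on \<Omega>)"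
    have "ennreal (1 / V powr (1 / r)) * LZ_norm \<Omega> (1 / c) r (\<kappa> - \<alpha> * c) f
       \<le> ennreal (1 / V powr (1 / r)) * (ennreal (V powr (1 / r)) * interp_norm \<Omega> N0 N1 \<theta> r f)"
      by (intro mult_left_mono main f) auto
    also have "\<dots> = interp_norm \<Omega> N0 N1 \<theta> r f"
      using V by (simp flip: mult.assoc ennreal_mult)
    finally show "ennreal (1 / V powr (1 / r)) * LZ_norm \<Omega> (1 / c) r (\<kappa> - \<alpha> * c) f \<le> interp_norm \<Omega> N0 N1 \<theta> r f" .
    show "interp_norm \<Omega> N0 N1 \<theta> r f \<le> ennreal (U powr (1 / r)) * LZ_norm \<Omega> (1 / c) r (\<kappa> - \<alpha> * c) f"
      by (rule main(2)[OF f])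
  qed (use U V in auto)
qed

end

section \<open>Choice of the parameters\<close>

theorem theorem3p5:
  fixes \<Omega> :: "'n::euclidean_space set" and a r \<beta> :: real
  assumes "open \<Omega>" and "bounded \<Omega>" and "measure lebesgue \<Omega> = 1"
    and "1 < a" and "1 < r" and "\<beta> \<noteq> 0"
  shows "(\<beta> < 0 \<longrightarrow> (\<exists>p q \<alpha> \<theta>. 1 < p \<and> p < q \<and> 0 < \<alpha> \<and> 0 < \<theta> \<and> \<theta> < 1 \<and>
            equiv_norms \<Omega> (LZ_norm \<Omega> a r \<beta>)
              (interp_norm \<Omega> (grand_norm \<Omega> p \<alpha>) (grand_norm \<Omega> q \<alpha>) \<theta> r)))
       \<and> (0 < \<beta> \<longrightarrow> (\<exists>p q \<alpha> \<theta>. 1 < p \<and> p < q \<and> 0 < \<alpha> \<and> 0 < \<theta> \<and> \<theta> < 1 \<and>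
            equiv_norms \<Omega> (LZ_norm \<Omega> a r \<beta>)
              (interp_norm \<Omega> (small_norm \<Omega> p \<alpha>) (small_norm \<Omega> q \<alpha>) \<theta> r)))"
proof -
  have \<Omega>: "\<Omega> \<in> lmeasurable" using assms(1,2) by (rule lmeasurable_open[rotated])
  \<comment> \<open>Convenient numbers with 1 < p < a < q; \<theta> then solves 1/a = (1 -
    \<theta>)/p + \<theta>/q.\<close>
  define p q \<theta> where "p = (1 + a) / 2" and "q = 2 * a" and "\<theta> = (1 / p - 1 / a) / (1 / p - 1 / q)"
  have pq: "1 < p" "p < a" "a < q" "p < q" using assms by (auto simp: p_def q_def)
  have inv: "1 / q < 1 / a" "1 / a < 1 / p" using pq by (auto intro!: divide_strict_left_mono)
  have \<theta>: "0 < \<theta>" "\<theta> < 1" using inv by (auto simp: \<theta>_def)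
  have c: "1 / a = (1 - \<theta>) * (1 / p) + \<theta> * (1 / q)"
  proof -
    have "\<theta> * (1 / p - 1 / q) = 1 / p - 1 / a" 
      using inv nonzero_eq_divide_eq[of "1 / p - 1 / q" \<theta> "1 / p - 1 / a"] by (simp only: \<theta>_def) linarith
    then show ?thesis by (simp add: algebra_simps diff_divide_distrib)
  qed
  have equiv: "equiv_norms \<Omega> (LZ_norm \<Omega> a r \<beta>) (interp_norm \<Omega> N0 N1 \<theta> r)"
    if "lorentz_sandwich \<Omega> (1 / p) (\<kappa> - \<alpha> * (1 / p)) N0" "lorentz_sandwich \<Omega> (1 / q) (\<kappa> - \<alpha> * (1 / q)) N1"
      "0 < \<alpha>" "\<beta> = \<kappa> - \<alpha> * (1 / a)" for N0 N1 :: "('n \<Rightarrow> real) \<Rightarrow> ennreal" and \<kappa> \<alpha>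
  proof -
    interpret sandwiched_couple \<Omega> N0 N1 "1 / p" "1 / q" \<kappa> \<alpha> \<theta> "1 / a"
      by unfold_locales (use that pq inv \<theta> c \<Omega> in auto)
    show ?thesis using equiv_norms_LZ_interp[OF \<open>1 < r\<close>] that(4) by simp
  qed
  show ?thesis
  proof (intro conjI impI)
    assume "\<beta> < 0"
    \<comment> \<open>Grand spaces have \<kappa> = 0, so this solves \<beta> = -\<alpha>/a and is
      positive exactly for \<beta> < 0.\<close>
    define \<alpha> where "\<alpha> = - \<beta> * a"
    have \<alpha>: "0 < \<alpha>" using \<open>\<beta> < 0\<close> assms by (simp add: \<alpha>_def mult_neg_pos)
    have "equiv_norms \<Omega> (LZ_norm \<Omega> a r \<beta>) (interp_norm \<Omega> (grand_norm \<Omega> p \<alpha>) (grand_norm \<Omega> q \<alpha>) \<theta> r)"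
      using lorentz_sandwich_grand[OF \<Omega> _ \<alpha>, of p] lorentz_sandwich_grand[OF \<Omega> _ \<alpha>, of q] pq assms \<alpha>
      by (intro equiv[of 0 \<alpha>]) (auto simp: \<alpha>_def)
    then show "\<exists>p q \<alpha> \<theta>. 1 < p \<and> p < q \<and> 0 < \<alpha> \<and> 0 < \<theta> \<and> \<theta> < 1 \<and>
            equiv_norms \<Omega> (LZ_norm \<Omega> a r \<beta>)
              (interp_norm \<Omega> (grand_norm \<Omega> p \<alpha>) (grand_norm \<Omega> q \<alpha>) \<theta> r)"
      using pq \<alpha> \<theta> by blast
  next
    assume "0 < \<beta>"
    \<comment> \<open>Small spaces have \<kappa> = \<alpha>, so this solves \<beta> = \<alpha> (1 -
      1/a); positivity uses a > 1.\<close>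
    define \<alpha> where "\<alpha> = \<beta> * a / (a - 1)"
    have \<alpha>: "0 < \<alpha>" using \<open>0 < \<beta>\<close> assms by (simp add: \<alpha>_def)
    have "\<alpha> - \<alpha> * (1 / a) = (\<beta> * a - \<beta>) / (a - 1)"
      using assms by (simp add: \<alpha>_def diff_divide_distrib)
    also have "\<beta> * a - \<beta> = \<beta> * (a - 1)" by (simp add: right_diff_distrib)
    finally have "\<beta> = \<alpha> - \<alpha> * (1 / a)" using assms by simp
    then have "equiv_norms \<Omega> (LZ_norm \<Omega> a r \<beta>) (interp_norm \<Omega> (small_norm \<Omega> p \<alpha>) (small_norm \<Omega> q \<alpha>) \<theta> r)"
      using lorentz_sandwich_small[OF \<Omega> _ \<alpha>, of p] lorentz_sandwich_small[OF \<Omega> _ \<alpha>, of q] pq \<alpha>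
      by (intro equiv[of \<alpha> \<alpha>]) auto
    then show "\<exists>p q \<alpha> \<theta>. 1 < p \<and> p < q \<and> 0 < \<alpha> \<and> 0 < \<theta> \<and> \<theta> < 1 \<and>
            equiv_norms \<Omega> (LZ_norm \<Omega> a r \<beta>)
              (interp_norm \<Omega> (small_norm \<Omega> p \<alpha>) (small_norm \<Omega> q \<alpha>) \<theta> r)"
      using pq \<alpha> \<theta> by blast
  qed
qed

end
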